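(* With $z_2$, $z_{\mathrm{SL}}$, $z_{\mathrm{RL}}$ the second-order, signed and recursive-line Zarankiewicz parameters, $$z_2(4,4)=z_{\mathrm{SL}}(4,4)=z_{\mathrm{RL}}(4,4)=10.$$ Moreover, the irreducible limited $4\times4$ configurations $G$ with $R(G)=10$ displayed squares form a single isomorphism class under row and column permutations.
   Context: Configurations. Fix $m,n\ge1$. Identify the cell $(i,j)$ (row $i$, column $j$) of the $m\times n$ grid with the monomial $u_{ij}=x_iy_j$ in real variables $x_1,\dots,x_m,y_1,\dots,y_n$. A bilinear form is a real linear combination of the $u_{ij}$. If $P$ is a sum of squares of real bilinear forms, $\mathrm{SOS}(P)$ is the least number of squares in such a representation. A one-edge is a single cell; a two-edge is an unordered pair of two distinct cells (possibly in a common row or column). An augmented configuration $G$ consists of a set $E_1$ of one-edges and a set $E_2$ of two-edges, together called the selected edges; $G$ is simple if distinct selected edges have disjoint supports (sets of cells). Put $P_G=\sum_{(i,j)\in E_1}u_{ij}^2+\sum_{\{(i,j),(k,\ell)\}\in E_2}(u_{ij}+u_{k\ell})^2$ and $R(G)=|E_1|+|E_2|$ (number of displayed squares). $G$ is irreducible if $\mathrm{SOS}(P_G)=R(G)$. $z(m,n)$ is the maximum number of edges of a $C_4$-free bipartite graph with parts $[m]$ (rows) and $[n]$ (columns), i.e. of a set of cells containing no four corners of two rows and two columns. $G$ is limited if it is simple, $E_1$ is $C_4$-free and $|E_1|=z(m,n)$. $z_2(m,n)$ is the maximum of $R(G)$ over irreducible limited $m\times n$ configurations. Two configurations are isomorphic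 if a row permutation together with a column permutation carries the one-edge set and two-edge set of one to those of the other. The condition $(RW3^+)$. For a simple $G$ let $\Omega$ be the set of cells occupied by selected edges, and for distinct cells let $\delta(p,q)=1$ if $\{p,q\}\in E_2$ and $0$ otherwise. A genuine rectangle is given by two distinct rows and two distinct columns; its two diagonals are the two pairs of opposite corners. Let $\sim$ (an equivalence relation on $\Omega$) and $\perp_R$ (a symmetric relation on $\Omega$) be the least relations closed under: (1) Line rule: if distinct $p,q\in\Omega$ lie in a common row or column, then $p\sim q$ if $\delta(p,q)=1$ and $p\perp_R q$ if $\delta(p,q)=0$. (2) Saturation: if $p\sim p'$, $q\sim q'$, $p'\perp_R q'$ then $p\perp_R q$. (3) Rectangle transfer: let $\{p,q\},\{r,s\}$ be the two diagonals of a genuine rectangle and suppose $\{r,s\}$ is certified, meaning: if $\delta(r,s)=0$, then at least one of $r,s$ is unoccupied or ($r,s\in\Omega$ and $r\perp_R s$); if $\delta(r,s)=1$, then $r\sim s$. Then: if $p,q\in\Omega$ and $\delta(p,q)=0$, $p\perp_R q$; if $\delta(p,q)=1$, $p\sim q$. (4) Complementary pair: if both diagonals $\{p,q\},\{r,s\}$ of a genuine rectangle are in $E_2$, then $p\sim q$ and $r\sim s$. $G$ is $(RW3^+)$-admissible if the two halves of every selected two-edge are $\sim$-equivalent, distinct selected edges lie in distinct $\sim$-classes, and every two distinct selected edges have representatives $p,q$ with $p\perp_R q$. $z_{\mathrm{RL}}(m,n)$ is the maximum of $R(G)$ over limited $(RW3^+)$-admissible $m\times n$ configurations. The parameter $z_{\mathrm{SL}}(m,n)$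 is defined analogously to $z_{\mathrm{RL}}$ with a signed condition $(RW3^{\pm})$ from the literature (Löfberg–Qi) in place of $(RW3^+)$; the only property of it to be used is the established hierarchy $z_2(m,n)\ge z_{\mathrm{SL}}(m,n)\ge z_{\mathrm{RL}}(m,n)$, so it may be treated as any integer satisfying these inequalities. *)

theory Defs
  imports Complex_Main "HOL-Library.Disjoint_Sets" "HOL-Combinatorics.Permutations"
begin

type_synonym cell = "nat \<times> nat"

definition grid :: "nat \<Rightarrow> nat \<Rightarrow> cell set" where
  "grid m n = {1..m} \<times> {1..n}"

text \<open>
  Polynomials in the real variables \<open>x\<^sub>1, \<dots>, x\<^sub>m, y\<^sub>1, \<dots>, y\<^sub>n\<close> are represented by the
  polynomial functions they induce; over the reals equality of the functions is equality of
  the polynomials. Values of \<open>x\<close> outside \<open>{1..m}\<close> and of \<open>y\<close> outside \<open>{1..n}\<close> are irrelevant.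
\<close>

type_synonym form = "(nat \<Rightarrow> real) \<Rightarrow> (nat \<Rightarrow> real) \<Rightarrow> real"

definition u_mon :: "cell \<Rightarrow> form" where
  "u_mon p x y = x (fst p) * y (snd p)"

definition bilinear_form :: "nat \<Rightarrow> nat \<Rightarrow> form \<Rightarrow> bool" where
  "bilinear_form m n f \<longleftrightarrow> (\<exists>c :: cell \<Rightarrow> real. f = (\<lambda>x y. \<Sum>p\<in>grid m n. c p * u_mon p x y))"

definition is_SOS_of :: "nat \<Rightarrow> nat \<Rightarrow> form \<Rightarrow> nat \<Rightarrow> bool" where
  "is_SOS_of m n P k \<longleftrightarrow>
     (\<exists>f :: nat \<Rightarrow> form. (\<forall>t<k. bilinear_form m n (f t)) \<and> P = (\<lambda>x y. \<Sum>t<k. (f t x y)\<^sup>2))"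

text \<open>Meaningful only when \<open>P\<close> is a sum of squares of bilinear forms.\<close>

definition SOS :: "nat \<Rightarrow> nat \<Rightarrow> form \<Rightarrow> nat" where
  "SOS m n P = (LEAST k. is_SOS_of m n P k)"

text \<open>A two-edge is the two-element set of its cells.\<close>

datatype config = Config (one_edges: "cell set") (two_edges: "cell set set")

definition configs :: "nat \<Rightarrow> nat \<Rightarrow> config set" where
  "configs m n = {G. one_edges G \<subseteq> grid m n \<and> (\<forall>e\<in>two_edges G. e \<subseteq> grid m n \<and> card e = 2)}"

text \<open>
  The selected edges, each identified with its support. No two selected edges are confused,
  since the supports of one-edges are singletons.
\<close>

definition selected_edges :: "config \<Rightarrow> cell set set" where
  "selected_edges G = {{p} | p. p \<in> one_edges G} \<union> two_edges G"

definition simple_config :: "config \<Rightarrow> bool" where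
  "simple_config G \<longleftrightarrow> disjoint (selected_edges G)"

definition P_of :: "config \<Rightarrow> form" where
  "P_of G x y = (\<Sum>p\<in>one_edges G. (u_mon p x y)\<^sup>2) + (\<Sum>e\<in>two_edges G. (\<Sum>p\<in>e. u_mon p x y)\<^sup>2)"

definition R_of :: "config \<Rightarrow> nat" where
  "R_of G = card (one_edges G) + card (two_edges G)"

definition irreducible_config :: "nat \<Rightarrow> nat \<Rightarrow> config \<Rightarrow> bool" where
  "irreducible_config m n G \<longleftrightarrow> SOS m n (P_of G) = R_of G"

definition C4_free :: "cell set \<Rightarrow> bool" where
  "C4_free E \<longleftrightarrow>
     \<not> (\<exists>i k j l. i \<noteq> k \<and> j \<noteq> l \<and> (i, j) \<in> E \<and> (i, l) \<in> E \<and> (k, j) \<in> E \<and> (k, l) \<in> E)"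

definition zarankiewicz :: "nat \<Rightarrow> nat \<Rightarrow> nat" where
  "zarankiewicz m n = Max (card ` {E. E \<subseteq> grid m n \<and> C4_free E})"

definition limited :: "nat \<Rightarrow> nat \<Rightarrow> config \<Rightarrow> bool" where
  "limited m n G \<longleftrightarrow>
     G \<in> configs m n \<and> simple_config G \<and> C4_free (one_edges G) \<and> card (one_edges G) = zarankiewicz m n"

definition z2 :: "nat \<Rightarrow> nat \<Rightarrow> nat" where
  "z2 m n = Max (R_of ` {G. limited m n G \<and> irreducible_config m n G})"

definition isomorphic_rel :: "nat \<Rightarrow> nat \<Rightarrow> (config \<times> config) set" where
  "isomorphic_rel m n = {(G, H). G \<in> configs m n \<and> H \<in> configs m n \<and>
     (\<exists>\<sigma> \<tau>. \<sigma> permutes {1..m} \<and> \<tau> permutes {1..n} \<and>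
        one_edges H = map_prod \<sigma> \<tau> ` one_edges G \<and>
        two_edges H = (\<lambda>e. map_prod \<sigma> \<tau> ` e) ` two_edges G)}"

lemma map_prod_inv_image:
  assumes "\<sigma> permutes A" "\<tau> permutes B"
  shows "map_prod (inv \<sigma>) (inv \<tau>) ` (map_prod \<sigma> \<tau> ` X) = X"
  using assms by (simp add: image_image map_prod_def case_prod_unfold permutes_inverses)

lemma equiv_isomorphic_rel: "equiv (configs m n) (isomorphic_rel m n)"
proof (rule equivI)
  show "isomorphic_rel m n \<subseteq> configs m n \<times> configs m n"
    by (auto simp: isomorphic_rel_def)
  show "refl_on (configs m n) (isomorphic_rel m n)"
    by (rule refl_onI)
      (auto simp: isomorphic_rel_def map_prod.id intro!: exI[of _ id] permutes_id)
  show "sym (isomorphic_rel m n)"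
  proof (rule symI)
    fix G H assume "(G, H) \<in> isomorphic_rel m n"
    then obtain \<sigma> \<tau> where *: "G \<in> configs m n" "H \<in> configs m n"
      "\<sigma> permutes {1..m}" "\<tau> permutes {1..n}"
      "one_edges H = map_prod \<sigma> \<tau> ` one_edges G"
      "two_edges H = (\<lambda>e. map_prod \<sigma> \<tau> ` e) ` two_edges G"
      by (auto simp: isomorphic_rel_def)
    show "(H, G) \<in> isomorphic_rel m n"
      unfolding isomorphic_rel_def
      apply (rule CollectI, rule case_prodI, intro conjI *)
      apply (rule exI[of _ "inv \<sigma>"], rule exI[of _ "inv \<tau>"], intro conjI permutes_inv *)
      unfolding *(5,6) image_image[of "\<lambda>e. _ ` e"] map_prod_inv_image[OF *(3,4)] by simp_all
  qed
  show "trans (isomorphic_rel m n)"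
  proof (rule transI)
    fix G H K assume "(G, H) \<in> isomorphic_rel m n" "(H, K) \<in> isomorphic_rel m n"
    then obtain \<sigma> \<tau> \<sigma>' \<tau>' where *: "G \<in> configs m n" "K \<in> configs m n"
      "\<sigma> permutes {1..m}" "\<tau> permutes {1..n}" "\<sigma>' permutes {1..m}" "\<tau>' permutes {1..n}"
      "one_edges H = map_prod \<sigma> \<tau> ` one_edges G"
      "two_edges H = (\<lambda>e. map_prod \<sigma> \<tau> ` e) ` two_edges G"
      "one_edges K = map_prod \<sigma>' \<tau>' ` one_edges H"
      "two_edges K = (\<lambda>e. map_prod \<sigma>' \<tau>' ` e) ` two_edges H"
      by (auto simp: isomorphic_rel_def)
    show "(G, K) \<in> isomorphic_rel m n"
      unfolding isomorphic_rel_def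
      apply (rule CollectI, rule case_prodI, intro conjI *)
      apply (rule exI[of _ "\<sigma>' \<circ> \<sigma>"], rule exI[of _ "\<tau>' \<circ> \<tau>"])
      using * by (simp add: permutes_compose image_image map_prod_def case_prod_unfold)
  qed
qed

definition occupied :: "config \<Rightarrow> cell set" where
  "occupied G = \<Union> (selected_edges G)"

text \<open>\<open>\<delta> G p q\<close> stands for \<open>\<delta>(p, q) = 1\<close>, its negation for \<open>\<delta>(p, q) = 0\<close>.\<close>

definition \<delta> :: "config \<Rightarrow> cell \<Rightarrow> cell \<Rightarrow> bool" where
  "\<delta> G p q \<longleftrightarrow> p \<noteq> q \<and> {p, q} \<in> two_edges G"

definition collinear :: "cell \<Rightarrow> cell \<Rightarrow> bool" where
  "collinear p q \<longleftrightarrow> fst p = fst q \<or> snd p = snd q"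

text \<open>
  \<open>{p, q}\<close> and \<open>{r, s}\<close> are the two diagonals of a genuine rectangle. It suffices to let \<open>r\<close>
  be the corner in the row of \<open>p\<close>, because all uses below are symmetric in \<open>r\<close> and \<open>s\<close>.
\<close>

definition diagonals :: "cell \<Rightarrow> cell \<Rightarrow> cell \<Rightarrow> cell \<Rightarrow> bool" where
  "diagonals p q r s \<longleftrightarrow>
     fst p \<noteq> fst q \<and> snd p \<noteq> snd q \<and> r = (fst p, snd q) \<and> s = (fst q, snd p)"

text \<open>\<open>sim G\<close> and \<open>perp G\<close> are the least relations \<open>\<sim>\<close> and \<open>\<perp>\<^sub>R\<close> on \<open>occupied G\<close>.\<close>

inductive sim :: "config \<Rightarrow> cell \<Rightarrow> cell \<Rightarrow> bool"
  and perp :: "config \<Rightarrow> cell \<Rightarrow> cell \<Rightarrow> bool"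
  for G :: config where
  sim_refl: "p \<in> occupied G \<Longrightarrow> sim G p p"
| sim_sym: "sim G p q \<Longrightarrow> sim G q p"
| sim_trans: "sim G p q \<Longrightarrow> sim G q r \<Longrightarrow> sim G p r"
| perp_sym: "perp G p q \<Longrightarrow> perp G q p"
| line_sim: "\<lbrakk>p \<in> occupied G; q \<in> occupied G; p \<noteq> q; collinear p q; \<delta> G p q\<rbrakk> \<Longrightarrow> sim G p q"
| line_perp: "\<lbrakk>p \<in> occupied G; q \<in> occupied G; p \<noteq> q; collinear p q; \<not> \<delta> G p q\<rbrakk> \<Longrightarrow> perp G p q"
| saturation: "\<lbrakk>sim G p p'; sim G q q'; perp G p' q'\<rbrakk> \<Longrightarrow> perp G p q"
| rectangle_perp:
    "\<lbrakk>diagonals p q r s;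
      \<not> \<delta> G r s \<longrightarrow> r \<notin> occupied G \<or> s \<notin> occupied G \<or>
        (r \<in> occupied G \<and> s \<in> occupied G \<and> perp G r s);
      \<delta> G r s \<longrightarrow> sim G r s;
      p \<in> occupied G; q \<in> occupied G; \<not> \<delta> G p q\<rbrakk> \<Longrightarrow> perp G p q"
| rectangle_sim:
    "\<lbrakk>diagonals p q r s;
      \<not> \<delta> G r s \<longrightarrow> r \<notin> occupied G \<or> s \<notin> occupied G \<or>
        (r \<in> occupied G \<and> s \<in> occupied G \<and> perp G r s);
      \<delta> G r s \<longrightarrow> sim G r s;
      \<delta> G p q\<rbrakk> \<Longrightarrow> sim G p q"
| complementary_pq: "\<lbrakk>diagonals p q r s; \<delta> G p q; \<delta> G r s\<rbrakk> \<Longrightarrow> sim G p q"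
| complementary_rs: "\<lbrakk>diagonals p q r s; \<delta> G p q; \<delta> G r s\<rbrakk> \<Longrightarrow> sim G r s"

definition RW3_plus_admissible :: "config \<Rightarrow> bool" where
  "RW3_plus_admissible G \<longleftrightarrow>
     (\<forall>e\<in>two_edges G. \<forall>p\<in>e. \<forall>q\<in>e. sim G p q) \<and>
     (\<forall>e\<in>selected_edges G. \<forall>f\<in>selected_edges G. e \<noteq> f \<longrightarrow>
        (\<forall>p\<in>e. \<forall>q\<in>f. \<not> sim G p q) \<and> (\<exists>p\<in>e. \<exists>q\<in>f. perp G p q))"

definition z_RL :: "nat \<Rightarrow> nat \<Rightarrow> nat" where
  "z_RL m n = Max (R_of ` {G. limited m n G \<and> RW3_plus_admissible G})"

end

theory Submission
  imports Defs
begin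

text \<open>
  If \<open>P\<^sub>G\<close> is a sum of \<open>k\<close> squares, the coefficients of the cells in these squares are vectors of
  \<open>\<real>\<^sup>k\<close> attached to the cells. Comparing coefficients prescribes their norms, the inner products of
  collinear cells, and the sum of the two inner products along the diagonals of each rectangle.
  Hence \<open>\<sim>\<close> forces equality and \<open>\<perp>\<^sub>R\<close> orthogonality of vectors, an admissible configuration carries
  \<open>R(G)\<close> orthonormal vectors, and so it is irreducible.

  Up to isomorphism the only \<open>C\<^sub>4\<close>-free set of nine cells consists of the cells \<open>(4, a)\<close>, \<open>(a, a)\<close>,
  \<open>(a, 4)\<close> with \<open>a \<in> {1, 2, 3}\<close>, and its complement of seven cells leaves five types of two-edges. Four
  types are reducible by explicit sums of squares, found from singular Gram matrices; the
  remaining type \<open>{(a, b), (b, c)}\<close> is admissible. Two disjoint two-edges of that type occur in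
  three ways, each reducible by another explicit sum of squares.
\<close>

subsection \<open>Sums of squares of bilinear forms\<close>

lemma finite_grid [simp]: "finite (grid m n)"
  by (simp add: grid_def)

lemma bilinear_form_u_mon:
  assumes "p \<in> grid m n"
  shows "bilinear_form m n (u_mon p)"
proof -
  have "(\<Sum>q\<in>grid m n. of_bool (q = p) * u_mon q x y) = u_mon p x y" for x y
    using assms by (simp add: of_bool_def if_distrib [of "\<lambda>c. c * _"] sum.delta cong: if_cong)
  then show ?thesis
    unfolding bilinear_form_def by (intro exI [of _ "\<lambda>q. of_bool (q = p)"]) (simp add: fun_eq_iff)
qed

lemma bilinear_form_monomial [intro]:
  assumes "i \<in> {1..m}" "j \<in> {1..n}"
  shows "bilinear_form m n (\<lambda>x y. x i * y j)"
proof -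
  have "(\<lambda>x y. x i * y j) = u_mon (i, j)"
    by (simp add: u_mon_def fun_eq_iff)
  then show ?thesis
    using assms bilinear_form_u_mon [of "(i, j)" m n] by (simp add: grid_def)
qed

lemma bilinear_form_add [intro]:
  assumes "bilinear_form m n f" "bilinear_form m n g"
  shows "bilinear_form m n (\<lambda>x y. f x y + g x y)"
proof -
  from assms obtain c d where f: "f = (\<lambda>x y. \<Sum>p\<in>grid m n. c p * u_mon p x y)"
    and g: "g = (\<lambda>x y. \<Sum>p\<in>grid m n. d p * u_mon p x y)"
    unfolding bilinear_form_def by blast
  show ?thesis
    unfolding bilinear_form_def f g
    by (intro exI [of _ "\<lambda>p. c p + d p"]) (simp add: distrib_right sum.distrib)
qed

lemma bilinear_form_scale [intro]:
  assumes "bilinear_form m n f"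
  shows "bilinear_form m n (\<lambda>x y. a * f x y)"
proof -
  from assms obtain c where f: "f = (\<lambda>x y. \<Sum>p\<in>grid m n. c p * u_mon p x y)"
    unfolding bilinear_form_def by blast
  show ?thesis
    unfolding bilinear_form_def f
    by (intro exI [of _ "\<lambda>p. a * c p"]) (simp add: sum_distrib_left mult.assoc)
qed

lemma bilinear_form_diff [intro]:
  assumes "bilinear_form m n f" "bilinear_form m n g"
  shows "bilinear_form m n (\<lambda>x y. f x y - g x y)"
  using bilinear_form_add [OF assms(1) bilinear_form_scale [OF assms(2), of "-1"]] by simp

lemma bilinear_form_sum:
  assumes "finite A" "\<And>a. a \<in> A \<Longrightarrow> bilinear_form m n (f a)"
  shows "bilinear_form m n (\<lambda>x y. \<Sum>a\<in>A. f a x y)"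
  using assms
proof (induction rule: finite_induct)
  case empty
  show ?case
    unfolding bilinear_form_def by (intro exI [of _ "\<lambda>_. 0"]) simp
qed (auto intro!: bilinear_form_add)

lemma is_SOS_of_sum:
  assumes "finite I" "\<And>i. i \<in> I \<Longrightarrow> bilinear_form m n (f i)"
  shows "is_SOS_of m n (\<lambda>x y. \<Sum>i\<in>I. (f i x y)\<^sup>2) (card I)"
proof -
  obtain h where h: "bij_betw h {..<card I} I"
    using ex_bij_betw_nat_finite [OF assms(1)] by (auto simp: atLeast0LessThan)
  show ?thesis
    unfolding is_SOS_of_def
    by (intro exI [of _ "f \<circ> h"] conjI ext)
      (use h assms(2) bij_betw_apply [OF h] in \<open>auto simp: sum.reindex_bij_betw [OF h, symmetric]\<close>)
qed

lemma is_SOS_of_add: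
  assumes "is_SOS_of m n P k" "is_SOS_of m n Q l"
  shows "is_SOS_of m n (\<lambda>x y. P x y + Q x y) (k + l)"
proof -
  from assms obtain f g where fg: "\<forall>t<k. bilinear_form m n (f t)" "\<forall>t<l. bilinear_form m n (g t)"
    and P: "P = (\<lambda>x y. \<Sum>t<k. (f t x y)\<^sup>2)" and Q: "Q = (\<lambda>x y. \<Sum>t<l. (g t x y)\<^sup>2)"
    unfolding is_SOS_of_def by blast
  have "(\<Sum>t<k + l. ((if t < k then f t else g (t - k)) x y)\<^sup>2) = P x y + Q x y" for x y
  proof -
    have "(\<Sum>t<k + l. ((if t < k then f t else g (t - k)) x y)\<^sup>2) =
      (\<Sum>t<k. ((if t < k then f t else g (t - k)) x y)\<^sup>2) +
      (\<Sum>t=k..<k + l. ((if t < k then f t else g (t - k)) x y)\<^sup>2)"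
      by (simp only: lessThan_atLeast0 sum.atLeastLessThan_concat le_add1 le0)
    also have "(\<Sum>t=k..<k + l. ((if t < k then f t else g (t - k)) x y)\<^sup>2) = Q x y"
      using sum.shift_bounds_nat_ivl [of "\<lambda>t. ((if t < k then f t else g (t - k)) x y)\<^sup>2" 0 k l]
      by (simp add: Q atLeast0LessThan add.commute)
    finally show ?thesis
      by (simp add: P)
  qed
  then show ?thesis
    unfolding is_SOS_of_def using fg
    by (intro exI [of _ "\<lambda>t. if t < k then f t else g (t - k)"]) auto
qed

text \<open>A nonnegative weight is absorbed into its form through its square root. Explicit
  certificates can thus be written with weights outside the squares, mostly rational ones, and
  checked by algebra.\<close>

lemma is_SOS_of_list:
  assumes "\<And>w f. (w, f) \<in> set ws \<Longrightarrow> w \<ge> 0 \<and> bilinear_form m n f"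
  shows "is_SOS_of m n (\<lambda>x y. \<Sum>(w, f)\<leftarrow>ws. w * (f x y)\<^sup>2) (length ws)"
proof -
  let ?f = "\<lambda>i x y. sqrt (fst (ws ! i)) * snd (ws ! i) x y"
  have pos: "fst (ws ! i) \<ge> 0 \<and> bilinear_form m n (snd (ws ! i))" if "i < length ws" for i
    using assms [of "fst (ws ! i)" "snd (ws ! i)"] that by simp
  have "is_SOS_of m n (\<lambda>x y. \<Sum>i<length ws. (?f i x y)\<^sup>2) (card {..<length ws})"
    by (rule is_SOS_of_sum) (use pos in auto)
  moreover have "(\<Sum>i<length ws. (?f i x y)\<^sup>2) = (\<Sum>(w, f)\<leftarrow>ws. w * (f x y)\<^sup>2)" for x y
    by (simp add: sum_list_sum_nth atLeast0LessThan power_mult_distrib pos case_prod_unfold)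
  ultimately show ?thesis
    by simp
qed

section \<open>Reducibility inherited from part of the two-edges\<close>

lemma finite_edges:
  assumes "G \<in> configs m n"
  shows "finite (one_edges G)" "finite (two_edges G)"
proof -
  have "two_edges G \<subseteq> Pow (grid m n)" "one_edges G \<subseteq> grid m n"
    using assms by (auto simp: configs_def)
  then show "finite (two_edges G)" "finite (one_edges G)"
    by (auto intro: finite_subset [OF _ finite_grid] finite_subset [of _ "Pow (grid m n)"])
qed

text \<open>The one-edges and the two-edges in \<open>F\<close> are rewritten with \<open>k\<close>
  squares, while each remaining two-edge keeps its displayed square. A saving on \<open>F\<close>
  therefore persists in \<open>G\<close>, so only small sets of two-edges need certificates.\<close>

lemma not_irreducibleI:
  assumes G: "G \<in> configs m n" and F: "F \<subseteq> two_edges G"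
    and sos: "is_SOS_of m n (P_of (Config (one_edges G) F)) k"
    and less: "k < card (one_edges G) + card F"
  shows "\<not> irreducible_config m n G"
proof -
  let ?F' = "two_edges G - F"
  note fin = finite_edges [OF G]
  have finF: "finite F"
    using F fin finite_subset by blast
  have edge: "bilinear_form m n (\<lambda>x y. \<Sum>p\<in>e. u_mon p x y)" if "e \<in> two_edges G" for e
  proof (rule bilinear_form_sum)
    have "e \<subseteq> grid m n"
      using that G by (auto simp: configs_def)
    then show "finite e" "\<And>p. p \<in> e \<Longrightarrow> bilinear_form m n (u_mon p)"
      using finite_subset [OF _ finite_grid] bilinear_form_u_mon by blast+
  qed
  have "is_SOS_of m n (\<lambda>x y. \<Sum>e\<in>?F'. (\<Sum>p\<in>e. u_mon p x y)\<^sup>2) (card ?F')"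
    by (rule is_SOS_of_sum) (use fin edge in auto)
  from is_SOS_of_add [OF sos this]
  have "is_SOS_of m n (P_of G) (k + card ?F')"
    by (simp add: P_of_def [abs_def] sum.subset_diff [OF F fin(2)] add.assoc add.commute add.left_commute)
  then have "SOS m n (P_of G) \<le> k + card ?F'"
    unfolding SOS_def by (rule Least_le)
  also have "\<dots> < R_of G"
    using less card_mono [OF fin(2) F] by (simp add: R_of_def card_Diff_subset [OF finF F])
  finally show ?thesis
    by (simp add: irreducible_config_def)
qed

subsection \<open>Gram vectors\<close>

lemma selected_edges_props:
  assumes "G \<in> configs m n"
  shows "finite (selected_edges G)" "card (selected_edges G) = R_of G"
    "P_of G x y = (\<Sum>e\<in>selected_edges G. (\<Sum>p\<in>e. u_mon p x y)\<^sup>2)"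
    "\<And>e. e \<in> selected_edges G \<Longrightarrow> e \<noteq> {} \<and> e \<subseteq> grid m n"
    "occupied G \<subseteq> grid m n"
proof -
  note fin = finite_edges [OF assms]
  have eq: "selected_edges G = (\<lambda>p. {p}) ` one_edges G \<union> two_edges G"
    by (auto simp: selected_edges_def)
  have card2: "e \<subseteq> grid m n \<and> card e = 2" if "e \<in> two_edges G" for e
    using that assms by (auto simp: configs_def)
  have disj: "(\<lambda>p. {p}) ` one_edges G \<inter> two_edges G = {}"
    using card2 by fastforce
  have inj: "inj_on (\<lambda>p. {p}) (one_edges G)"
    by (simp add: inj_on_def)
  show "finite (selected_edges G)"
    using fin by (simp add: eq)
  show "card (selected_edges G) = R_of G"
    using fin disj by (simp add: eq card_Un_disjoint card_image [OF inj] R_of_def)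
  show "P_of G x y = (\<Sum>e\<in>selected_edges G. (\<Sum>p\<in>e. u_mon p x y)\<^sup>2)"
    using fin disj by (simp add: eq sum.union_disjoint sum.reindex [OF inj] P_of_def)
  show *: "e \<noteq> {} \<and> e \<subseteq> grid m n" if "e \<in> selected_edges G" for e
    using that card2 assms by (fastforce simp: eq configs_def)
  show "occupied G \<subseteq> grid m n"
    using * by (auto simp: occupied_def)
qed

lemma is_SOS_of_P_of:
  assumes "G \<in> configs m n"
  shows "is_SOS_of m n (P_of G) (R_of G)"
proof -
  note * = selected_edges_props [OF assms]
  have "is_SOS_of m n (\<lambda>x y. \<Sum>e\<in>selected_edges G. (\<Sum>p\<in>e. u_mon p x y)\<^sup>2) (card (selected_edges G))"
  proof (intro is_SOS_of_sum bilinear_form_sum bilinear_form_u_mon)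
    show "finite e" if "e \<in> selected_edges G" for e
      using *(4) [OF that] finite_subset [OF _ finite_grid] by blast
  qed (use * in auto)
  then show ?thesis
    by (simp add: *(2) *(3) [abs_def])
qed

text \<open>Evaluation at 0/1 vectors extracts coefficient sums over boxes. This replaces the
  comparison of polynomial coefficients, since forms are represented as functions.\<close>

lemma form_indicator:
  assumes "A \<subseteq> {1..m}" "B \<subseteq> {1..n}"
  shows "(\<Sum>p\<in>grid m n. c p * u_mon p (\<lambda>i. of_bool (i \<in> A)) (\<lambda>j. of_bool (j \<in> B))) =
    (\<Sum>p\<in>A \<times> B. c p :: real)"
proof -
  have "(\<Sum>p\<in>grid m n. c p * u_mon p (\<lambda>i. of_bool (i \<in> A)) (\<lambda>j. of_bool (j \<in> B))) =
    (\<Sum>p\<in>grid m n. if p \<in> A \<times> B then c p else 0)"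
    by (intro sum.cong) (auto simp: u_mon_def)
  also have "\<dots> = (\<Sum>p\<in>grid m n \<inter> (A \<times> B). c p)"
    by (simp add: sum.inter_restrict)
  also have "grid m n \<inter> (A \<times> B) = A \<times> B"
    using assms by (auto simp: grid_def)
  finally show ?thesis .
qed

text \<open>The Gram matrix of the vectors formed by the coefficients of each cell. The index type
  is left open because the squares are indexed both by selected edges and by numbers.\<close>

definition gram :: "('t \<Rightarrow> cell \<Rightarrow> real) \<Rightarrow> 't set \<Rightarrow> cell \<Rightarrow> cell \<Rightarrow> real" where
  "gram c T p q = (\<Sum>t\<in>T. c t p * c t q)"

lemma gram_sym: "gram c T p q = gram c T q p"
  by (simp add: gram_def mult.commute)

lemma sum_squares_gram:
  assumes "finite A"
  shows "(\<Sum>t\<in>T. (\<Sum>p\<in>A. c t p)\<^sup>2) = (\<Sum>p\<in>A. \<Sum>q\<in>A. gram c T p q)"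
proof -
  have "(\<Sum>t\<in>T. (\<Sum>p\<in>A. c t p)\<^sup>2) = (\<Sum>t\<in>T. \<Sum>p\<in>A. \<Sum>q\<in>A. c t p * c t q)"
    by (simp add: power2_eq_square sum_product)
  also have "\<dots> = (\<Sum>p\<in>A. \<Sum>t\<in>T. \<Sum>q\<in>A. c t p * c t q)"
    by (rule sum.swap)
  also have "\<dots> = (\<Sum>p\<in>A. \<Sum>q\<in>A. gram c T p q)"
    unfolding gram_def by (intro sum.cong refl sum.swap)
  finally show ?thesis .
qed

lemma sum_gram_4:
  assumes "distinct [p, q, r, s]"
  shows "(\<Sum>a\<in>{p, q, r, s}. \<Sum>b\<in>{p, q, r, s}. gram c T a b) =
    gram c T p p + gram c T q q + gram c T r r + gram c T s s +
    2 * (gram c T p q + gram c T r s + gram c T p r + gram c T p s + gram c T q r + gram c T q s)"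
proof -
  note sym = gram_sym [of c T q p] gram_sym [of c T r p] gram_sym [of c T s p]
    gram_sym [of c T r q] gram_sym [of c T s q] gram_sym [of c T s r]
  show ?thesis
    using assms sym by simp
qed

text \<open>Equal polynomials agree on all 0/1 boxes. Boxes of one, two and four cells yield in turn
  the norms, the inner products of collinear cells and the diagonal sums of rectangles. A single
  diagonal is not determined, because both diagonals give the same monomial.\<close>

lemma gram_eq:
  assumes eq: "\<And>x y. (\<Sum>t\<in>T. (\<Sum>p\<in>grid m n. c t p * u_mon p x y)\<^sup>2) =
    (\<Sum>t\<in>T'. (\<Sum>p\<in>grid m n. c' t p * u_mon p x y)\<^sup>2)"
  shows "p \<in> grid m n \<Longrightarrow> gram c T p p = gram c' T' p p"
    and "\<lbrakk>p \<in> grid m n; q \<in> grid m n; collinear p q\<rbrakk> \<Longrightarrow> gram c T p q = gram c' T' p q"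
    and "\<lbrakk>p \<in> grid m n; q \<in> grid m n; diagonals p q r s\<rbrakk> \<Longrightarrow>
      gram c T p q + gram c T r s = gram c' T' p q + gram c' T' r s"
proof -
  have box: "(\<Sum>p\<in>A \<times> B. \<Sum>q\<in>A \<times> B. gram c T p q) = (\<Sum>p\<in>A \<times> B. \<Sum>q\<in>A \<times> B. gram c' T' p q)"
    if "A \<subseteq> {1..m}" "B \<subseteq> {1..n}" for A B
  proof -
    have fin: "finite (A \<times> B)"
      using finite_subset [OF that(1)] finite_subset [OF that(2)] by simp
    show ?thesis
      using eq [of "\<lambda>i. of_bool (i \<in> A)" "\<lambda>j. of_bool (j \<in> B)"]
      unfolding form_indicator [OF that] sum_squares_gram [OF fin] .
  qed
  show diag: "gram c T p p = gram c' T' p p" if "p \<in> grid m n" for p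
    using box [of "{fst p}" "{snd p}"] that by (auto simp: grid_def)
  show line: "gram c T p q = gram c' T' p q" if "p \<in> grid m n" "q \<in> grid m n" "collinear p q" for p q
  proof (cases "p = q")
    case False
    \<comment> \<open>For collinear cells one factor of the box is a singleton, so the box holds
      just these two cells.\<close>
    have "{fst p, fst q} \<times> {snd p, snd q} = {p, q}"
      using that by (cases p; cases q) (auto simp: collinear_def)
    then show ?thesis
      using box [of "{fst p, fst q}" "{snd p, snd q}"] that(1,2) False diag [OF that(1)] diag [OF that(2)]
      by (auto simp: grid_def gram_sym [of _ _ q p])
  qed (use diag that in auto)
  show "gram c T p q + gram c T r s = gram c' T' p q + gram c' T' r s"
    if *: "p \<in> grid m n" "q \<in> grid m n" "diagonals p q r s"
  proof -
    have rs: "r \<in> grid m n" "s \<in> grid m n"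
      using * by (auto simp: diagonals_def grid_def)
    have prod: "{fst p, fst q} \<times> {snd p, snd q} = {p, q, r, s}"
      using * by (cases p; cases q) (auto simp: diagonals_def)
    have "distinct [p, q, r, s]"
      using * by (cases p; cases q) (auto simp: diagonals_def)
    note sums = sum_gram_4 [OF this]
    have "collinear p r" "collinear p s" "collinear q r" "collinear q s"
      using * by (auto simp: collinear_def diagonals_def)
    note lines = line [OF *(1) rs(1) this(1)] line [OF *(1) rs(2) this(2)]
      line [OF *(2) rs(1) this(3)] line [OF *(2) rs(2) this(4)]
    have "{fst p, fst q} \<subseteq> {1..m}" "{snd p, snd q} \<subseteq> {1..n}"
      using * by (auto simp: grid_def)
    \<comment> \<open>Norms and the four collinear products already agree and cancel from the 2 by 2
      box sum, leaving twice the diagonal sum.\<close>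
    from box [OF this, unfolded prod sums] lines diag [OF *(1)] diag [OF *(2)] diag [OF rs(1)] diag [OF rs(2)]
    show ?thesis
      by simp
  qed
qed

text \<open>The squared distance of two unit vectors is 2 minus twice their inner product. This
  gives the Cauchy-Schwarz bound together with its equality case.\<close>

lemma gram_unit_vectors:
  assumes "finite T" "gram c T p p = 1" "gram c T q q = 1"
  shows "gram c T p q \<le> 1" "gram c T p q = 1 \<Longrightarrow> t \<in> T \<Longrightarrow> c t p = c t q"
proof -
  have *: "(\<Sum>t\<in>T. (c t p - c t q)\<^sup>2) = 2 - 2 * gram c T p q"
  proof -
    have "(\<Sum>t\<in>T. (c t p - c t q)\<^sup>2) = gram c T p p + gram c T q q - 2 * gram c T p q"
      by (simp add: gram_def power2_eq_square algebra_simps sum.distrib sum_subtractf sum_distrib_left)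
    then show ?thesis
      using assms by simp
  qed
  have "(\<Sum>t\<in>T. (c t p - c t q)\<^sup>2) \<ge> 0"
    by (simp add: sum_nonneg)
  then show "gram c T p q \<le> 1"
    using * by simp
  show "c t p = c t q" if "gram c T p q = 1" "t \<in> T"
  proof -
    have "(\<Sum>t\<in>T. (c t p - c t q)\<^sup>2) = 0"
      using * that by simp
    then show ?thesis
      using assms(1) that(2) by (simp add: sum_nonneg_eq_0_iff)
  qed
qed

lemma gram_eq_0_left:
  assumes "finite T" "gram c T p p = 0"
  shows "gram c T p q = 0"
proof -
  have "c t p = 0" if "t \<in> T" for t
    using assms that by (simp add: gram_def sum_nonneg_eq_0_iff)
  then show ?thesis
    by (simp add: gram_def)
qed

text \<open>Bessel's inequality for each standard basis vector, summed over the basis.\<close>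

lemma card_orthonormal_le:
  fixes w :: "'e \<Rightarrow> 't \<Rightarrow> real"
  assumes E: "finite E" and T: "finite T"
    and on: "\<And>e f. \<lbrakk>e \<in> E; f \<in> E\<rbrakk> \<Longrightarrow> (\<Sum>t\<in>T. w e t * w f t) = of_bool (e = f)"
  shows "card E \<le> card T"
proof -
  have bessel: "(\<Sum>e\<in>E. (w e s)\<^sup>2) \<le> 1" if s: "s \<in> T" for s
  proof -
    let ?v = "\<lambda>t. \<Sum>e\<in>E. w e s * w e t"
    \<comment> \<open>The vector \<open>?v\<close> is the orthogonal projection of the basis vector
      at \<open>s\<close> onto the span of the family \<open>w\<close>; the residual has squared
      norm 1 minus the sum to be bounded.\<close>
    have "0 \<le> (\<Sum>t\<in>T. (of_bool (t = s) - ?v t)\<^sup>2)"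
      by (simp add: sum_nonneg)
    also have "\<dots> = (\<Sum>t\<in>T. of_bool (t = s)) - 2 * (\<Sum>t\<in>T. of_bool (t = s) * ?v t) + (\<Sum>t\<in>T. (?v t)\<^sup>2)"
      by (simp add: power2_diff sum.distrib sum_subtractf sum_distrib_left mult.assoc
          of_bool_def if_distrib [of "\<lambda>c. c\<^sup>2"] cong: if_cong)
    also have "(\<Sum>t\<in>T. of_bool (t = s)) = (1 :: real)"
      using s T by (simp add: of_bool_def)
    also have "(\<Sum>t\<in>T. of_bool (t = s) * ?v t) = (\<Sum>e\<in>E. (w e s)\<^sup>2)"
      using s T by (simp add: of_bool_def if_distrib [of "\<lambda>c. c * _"] sum.delta power2_eq_square cong: if_cong)
    also have "(\<Sum>t\<in>T. (?v t)\<^sup>2) = (\<Sum>t\<in>T. \<Sum>e\<in>E. \<Sum>f\<in>E. w e s * w f s * (w e t * w f t))"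
      by (simp add: power2_eq_square sum_product mult_ac)
    also have "\<dots> = (\<Sum>e\<in>E. \<Sum>t\<in>T. \<Sum>f\<in>E. w e s * w f s * (w e t * w f t))"
      by (rule sum.swap)
    also have "\<dots> = (\<Sum>e\<in>E. \<Sum>f\<in>E. \<Sum>t\<in>T. w e s * w f s * (w e t * w f t))"
      by (intro sum.cong refl sum.swap)
    also have "\<dots> = (\<Sum>e\<in>E. \<Sum>f\<in>E. w e s * w f s * of_bool (e = f))"
      by (intro sum.cong refl) (simp add: sum_distrib_left [symmetric] on)
    also have "\<dots> = (\<Sum>e\<in>E. (w e s)\<^sup>2)"
      using E by (intro sum.cong refl)
        (simp add: of_bool_def if_distrib [of "\<lambda>c. _ * c"] sum.delta power2_eq_square cong: if_cong)
    finally show ?thesis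
      by simp
  qed
  have "real (card E) = (\<Sum>e\<in>E. \<Sum>s\<in>T. w e s * w e s)"
    using on by simp
  also have "\<dots> = (\<Sum>s\<in>T. \<Sum>e\<in>E. (w e s)\<^sup>2)"
    by (subst sum.swap) (simp add: power2_eq_square)
  also have "\<dots> \<le> (\<Sum>s\<in>T. 1)"
    by (intro sum_mono bessel)
  finally show ?thesis
    by simp
qed

section \<open>The Gram matrix of the displayed squares\<close>

lemma edge_eq:
  assumes "simple_config G" "e \<in> selected_edges G" "f \<in> selected_edges G" "p \<in> e" "p \<in> f"
  shows "e = f"
  using assms unfolding simple_config_def disjoint_def by blast

lemma \<delta>_occupied:
  assumes "\<delta> G p q"
  shows "p \<in> occupied G" "q \<in> occupied G"
  using assms by (auto simp: \<delta>_def occupied_def selected_edges_def)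

text \<open>In a simple configuration a cell lies in at most one selected edge, so two cells share
  at most one displayed square. By \<open>gram_eq\<close> these values constrain every other
  representation of the same polynomial.\<close>

lemma gram_incidence:
  assumes G: "G \<in> configs m n" and simple: "simple_config G"
  shows "gram (\<lambda>e p. of_bool (p \<in> e)) (selected_edges G) p q =
    of_bool (p = q \<and> p \<in> occupied G) + of_bool (\<delta> G p q)"
proof -
  have "gram (\<lambda>e p. of_bool (p \<in> e)) (selected_edges G) p q =
    (\<Sum>e\<in>selected_edges G. of_bool (p \<in> e \<and> q \<in> e))"
    by (simp add: gram_def of_bool_conj)
  also have "\<dots> = of_bool (\<exists>e\<in>selected_edges G. p \<in> e \<and> q \<in> e)"
  proof (cases "\<exists>e\<in>selected_edges G. p \<in> e \<and> q \<in> e")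
    case True
    then obtain e where e: "e \<in> selected_edges G" "p \<in> e" "q \<in> e"
      by blast
    have "p \<in> f \<and> q \<in> f \<longleftrightarrow> f = e" if "f \<in> selected_edges G" for f
      using edge_eq [OF simple that e(1) _ e(2)] e by blast
    then have "(\<Sum>f\<in>selected_edges G. of_bool (p \<in> f \<and> q \<in> f)) =
      (\<Sum>f\<in>selected_edges G. of_bool (f = e) :: real)"
      by simp
    then show ?thesis
      using True e(1) selected_edges_props(1) [OF G] by (simp add: of_bool_def)
  next
    case False
    then have "\<not> (p \<in> e \<and> q \<in> e)" if "e \<in> selected_edges G" for e
      using that by blast
    then have "(\<Sum>e\<in>selected_edges G. of_bool (p \<in> e \<and> q \<in> e)) = (0 :: real)"
      by (intro sum.neutral) simp
    with False show ?thesis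
      by simp
  qed
  also have "(\<exists>e\<in>selected_edges G. p \<in> e \<and> q \<in> e) \<longleftrightarrow> p = q \<and> p \<in> occupied G \<or> \<delta> G p q"
  proof (cases "p = q")
    case False
    have "e = {p, q}" if "e \<in> two_edges G" "p \<in> e" "q \<in> e" for e
    proof -
      have "card e = 2"
        using that G by (auto simp: configs_def)
      then show ?thesis
        using that(2,3) False by (auto simp: card_2_iff)
    qed
    moreover have "e \<in> two_edges G" if "e \<in> selected_edges G" "p \<in> e" "q \<in> e" for e
      using that False unfolding selected_edges_def by blast
    moreover have "two_edges G \<subseteq> selected_edges G"
      by (simp add: selected_edges_def)
    ultimately have "(\<exists>e\<in>selected_edges G. p \<in> e \<and> q \<in> e) \<longleftrightarrow> {p, q} \<in> two_edges G"
      by blast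
    then show ?thesis
      using False by (simp add: \<delta>_def)
  qed (auto simp: occupied_def \<delta>_def)
  finally show ?thesis
    by (auto simp: \<delta>_def)
qed

section \<open>Soundness of the rules in an arbitrary representation\<close>

locale sos_representation =
  fixes m n :: nat and G :: config and c :: "nat \<Rightarrow> cell \<Rightarrow> real" and k :: nat
  assumes config: "G \<in> configs m n" and simple: "simple_config G"
    and P_eq: "P_of G = (\<lambda>x y. \<Sum>t<k. (\<Sum>p\<in>grid m n. c t p * u_mon p x y)\<^sup>2)"
begin

abbreviation D :: "cell \<Rightarrow> cell \<Rightarrow> real" where
  "D \<equiv> gram c {..<k}"

lemma occupied_grid: "p \<in> occupied G \<Longrightarrow> p \<in> grid m n"
  using selected_edges_props(5) [OF config] by blast

lemma incidence_form:
  "(\<Sum>e\<in>selected_edges G. (\<Sum>p\<in>grid m n. of_bool (p \<in> e) * u_mon p x y)\<^sup>2) = P_of G x y"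
proof -
  have "(\<Sum>p\<in>grid m n. of_bool (p \<in> e) * u_mon p x y) = (\<Sum>p\<in>e. u_mon p x y)"
    if "e \<in> selected_edges G" for e
  proof -
    have "(\<Sum>p\<in>grid m n. of_bool (p \<in> e) * u_mon p x y) = (\<Sum>p\<in>grid m n. if p \<in> e then u_mon p x y else 0)"
      by (intro sum.cong) auto
    also have "\<dots> = (\<Sum>p\<in>grid m n \<inter> e. u_mon p x y)"
      by (simp add: sum.inter_restrict)
    also have "grid m n \<inter> e = e"
      using selected_edges_props(4) [OF config that] by blast
    finally show ?thesis .
  qed
  then show ?thesis
    by (simp add: selected_edges_props(3) [OF config])
qed

lemma D_simps:
  shows D_self: "p \<in> grid m n \<Longrightarrow> D p p = of_bool (p \<in> occupied G)"
    and D_line: "\<lbrakk>p \<in> grid m n; q \<in> grid m n; p \<noteq> q; collinear p q\<rbrakk> \<Longrightarrow> D p q = of_bool (\<delta> G p q)"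
    and D_rectangle: "\<lbrakk>p \<in> grid m n; q \<in> grid m n; diagonals p q r s\<rbrakk> \<Longrightarrow>
      D p q + D r s = of_bool (\<delta> G p q) + of_bool (\<delta> G r s)"
proof -
  have "(\<Sum>t<k. (\<Sum>p\<in>grid m n. c t p * u_mon p x y)\<^sup>2) =
    (\<Sum>e\<in>selected_edges G. (\<Sum>p\<in>grid m n. of_bool (p \<in> e) * u_mon p x y)\<^sup>2)" for x y
    unfolding incidence_form P_eq ..
  note eq = gram_eq [OF this, unfolded gram_incidence [OF config simple]]
  show "D p p = of_bool (p \<in> occupied G)" if "p \<in> grid m n"
    using eq(1) [OF that] by (simp add: \<delta>_def)
  show "D p q = of_bool (\<delta> G p q)" if "p \<in> grid m n" "q \<in> grid m n" "p \<noteq> q" "collinear p q"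
    using eq(2) [OF that(1,2,4)] that(3) by simp
  show "D p q + D r s = of_bool (\<delta> G p q) + of_bool (\<delta> G r s)"
    if "p \<in> grid m n" "q \<in> grid m n" "diagonals p q r s"
    using eq(3) [OF that] that(3) by (auto simp: diagonals_def)
qed

lemma D_eq_1:
  assumes "p \<in> occupied G" "q \<in> occupied G"
  shows "D p q \<le> 1" "D p q = 1 \<Longrightarrow> \<forall>t<k. c t p = c t q"
  using gram_unit_vectors [of "{..<k}" c p q] assms occupied_grid by (auto simp: D_self)

lemma D_unoccupied:
  assumes "p \<in> grid m n" "p \<notin> occupied G"
  shows "D p q = 0" "D q p = 0"
  using gram_eq_0_left [of "{..<k}" c p q] assms by (auto simp: D_self gram_sym [of _ _ q p])

lemma D_cong: "\<lbrakk>\<forall>t<k. c t p = c t p'; \<forall>t<k. c t q = c t q'\<rbrakk> \<Longrightarrow> D p q = D p' q'"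
  by (auto simp: gram_def)

text \<open>Certification fixes \<open>D r s\<close> at its displayed value: an unoccupied cell has
  the zero vector, and a selected certified pair has equal unit vectors. The diagonal sum then fixes
  \<open>D p q\<close> as well.\<close>

lemma certified_diagonal:
  assumes "diagonals p q r s" "p \<in> occupied G" "q \<in> occupied G"
    and "\<not> \<delta> G r s \<longrightarrow> r \<notin> occupied G \<or> s \<notin> occupied G \<or> D r s = 0"
    and "\<delta> G r s \<longrightarrow> (\<forall>t<k. c t r = c t s)"
  shows "D p q = of_bool (\<delta> G p q)"
proof -
  have pq: "p \<in> grid m n" "q \<in> grid m n" and rs: "r \<in> grid m n" "s \<in> grid m n"
    using assms(1) occupied_grid [OF assms(2)] occupied_grid [OF assms(3)]
    by (auto simp: diagonals_def grid_def)
  have "D r s = of_bool (\<delta> G r s)"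
  proof (cases "\<delta> G r s")
    case True
    then have "D r s = D r r"
      using assms(5) by (intro D_cong) auto
    then show ?thesis
      using True \<delta>_occupied [OF True] rs by (simp add: D_self)
  next
    case False
    then show ?thesis
      using assms(4) D_unoccupied [OF rs(1), of s] D_unoccupied [OF rs(2), of r] by auto
  qed
  then show ?thesis
    using D_rectangle [OF pq assms(1)] by simp
qed

text \<open>The two inner products sum to 2 and neither exceeds 1, so both equal 1.\<close>

lemma complementary:
  assumes "diagonals p q r s" "\<delta> G p q" "\<delta> G r s"
  shows "D p q = 1" "D r s = 1"
proof -
  note occ = \<delta>_occupied [OF assms(2)] \<delta>_occupied [OF assms(3)]
  have "D p q + D r s = 2"
    using D_rectangle [OF _ _ assms(1)] occ occupied_grid assms by auto
  then show "D p q = 1" "D r s = 1"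
    using D_eq_1(1) [OF occ(1,2)] D_eq_1(1) [OF occ(3,4)] by linarith+
qed

text \<open>Simultaneous induction over the rules: \<open>sim\<close> forces equal coefficient
  vectors and \<open>perp\<close> forces orthogonal ones. New equalities come from inner product 1
  between unit vectors.\<close>

lemma
  shows sim_sound: "sim G p q \<Longrightarrow> \<forall>t<k. c t p = c t q"
    and perp_sound: "perp G p q \<Longrightarrow> D p q = 0"
proof (induction rule: sim_perp.inducts)
  case (perp_sym p q)
  then show ?case
    by (simp add: gram_sym)
next
  case (line_sim p q)
  then show ?case
    by (intro D_eq_1(2)) (auto simp: D_line occupied_grid)
next
  case (line_perp p q)
  then show ?case
    by (auto simp: D_line occupied_grid)
next
  case (saturation p p' q q')
  then show ?case
    using D_cong by metis
next
  case (rectangle_perp p q r s)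
  then show ?case
    using certified_diagonal [of p q r s] by auto
next
  case (rectangle_sim p q r s)
  then show ?case
    using certified_diagonal [of p q r s] \<delta>_occupied [of G p q] by (intro D_eq_1(2)) auto
next
  case (complementary_pq p q r s)
  then show ?case
    using complementary \<delta>_occupied by (intro D_eq_1(2)) blast+
next
  case (complementary_rs p q r s)
  then show ?case
    using complementary \<delta>_occupied by (intro D_eq_1(2)) blast+
next
  case (sim_sym p q)
  then show ?case
    by (metis)
next
  case (sim_trans p q r)
  then show ?case
    by (metis)
qed (rule allI impI refl)+

text \<open>One vector per selected edge gives an orthonormal family in a space of dimension
  \<open>k\<close>.\<close>

lemma admissible_card_le:
  assumes adm: "RW3_plus_admissible G"
  shows "R_of G \<le> k"
proof -
  \<comment> \<open>Any cell of the edge serves: by admissibility all cells of an edge carry the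
    same vector, so orthogonality of some pair of cells passes to the representatives.\<close>
  define rep where "rep e = (SOME p. p \<in> e)" for e :: "cell set"
  have rep: "rep e \<in> e" if "e \<in> selected_edges G" for e
    using selected_edges_props(4) [OF config that] by (auto simp: rep_def some_in_eq)
  have rep_eq: "\<forall>t<k. c t (rep e) = c t p" if "e \<in> selected_edges G" "p \<in> e" for e p
  proof (cases "e \<in> two_edges G")
    case True
    then have "sim G (rep e) p"
      using adm rep [OF that(1)] that(2) unfolding RW3_plus_admissible_def by blast
    then show ?thesis
      by (rule sim_sound)
  next
    case False
    then have "rep e = p"
      using that rep [OF that(1)] unfolding selected_edges_def by blast
    then show ?thesis
      by simp
  qed
  have occ: "rep e \<in> occupied G" if "e \<in> selected_edges G" for e
    using rep [OF that] that by (auto simp: occupied_def)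
  have "(\<Sum>t<k. c t (rep e) * c t (rep f)) = of_bool (e = f)"
    if ef: "e \<in> selected_edges G" "f \<in> selected_edges G" for e f
  proof (cases "e = f")
    case True
    then show ?thesis
      using D_self [OF occupied_grid [OF occ [OF ef(1)]]] occ [OF ef(1)] by (simp add: gram_def)
  next
    case False
    then have "\<exists>p\<in>e. \<exists>q\<in>f. perp G p q"
      using adm ef by (simp add: RW3_plus_admissible_def)
    then obtain p q where pq: "p \<in> e" "q \<in> f" "perp G p q"
      by blast
    have "D (rep e) (rep f) = D p q"
      by (rule D_cong [OF rep_eq [OF ef(1) pq(1)] rep_eq [OF ef(2) pq(2)]])
    then show ?thesis
      using False perp_sound [OF pq(3)] by (simp add: gram_def)
  qed
  then have "card (selected_edges G) \<le> card {..<k}"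
    by (intro card_orthonormal_le [where w = "\<lambda>e t. c t (rep e)"] selected_edges_props(1) [OF config]) auto
  then show ?thesis
    by (simp add: selected_edges_props(2) [OF config])
qed

end

text \<open>The displayed squares bound \<open>SOS\<close> from above;
  \<open>admissible_card_le\<close>, applied to the coefficients of any representation, bounds it
  from below.\<close>

theorem admissible_irreducible:
  assumes G: "G \<in> configs m n" and "simple_config G" "RW3_plus_admissible G"
  shows "irreducible_config m n G"
  unfolding irreducible_config_def SOS_def
proof (rule Least_equality)
  show "is_SOS_of m n (P_of G) (R_of G)"
    by (rule is_SOS_of_P_of [OF G])
next
  fix k
  assume "is_SOS_of m n (P_of G) k"
  then have "\<exists>f. (\<forall>t<k. bilinear_form m n (f t)) \<and> P_of G = (\<lambda>x y. \<Sum>t<k. (f t x y)\<^sup>2)"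
    unfolding is_SOS_of_def .
  then obtain f where f: "\<forall>t<k. bilinear_form m n (f t)" and P: "P_of G = (\<lambda>x y. \<Sum>t<k. (f t x y)\<^sup>2)"
    by (elim exE conjE)
  have "\<forall>t. \<exists>c. t < k \<longrightarrow> f t = (\<lambda>x y. \<Sum>p\<in>grid m n. c p * u_mon p x y)"
    using f by (simp add: bilinear_form_def)
  from choice [OF this]
  obtain c where c: "\<forall>t. t < k \<longrightarrow> f t = (\<lambda>x y. \<Sum>p\<in>grid m n. c t p * u_mon p x y)"
    by (elim exE)
  have "(\<Sum>t<k. (f t x y)\<^sup>2) = (\<Sum>t<k. (\<Sum>p\<in>grid m n. c t p * u_mon p x y)\<^sup>2)" for x y
    using c by (intro sum.cong) simp_all
  then have "P_of G = (\<lambda>x y. \<Sum>t<k. (\<Sum>p\<in>grid m n. c t p * u_mon p x y)\<^sup>2)"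
    unfolding P by (simp only:)
  with assms(1,2) have "sos_representation m n G c k"
    by (rule sos_representation.intro)
  then show "R_of G \<le> k"
    using assms(3) by (rule sos_representation.admissible_card_le)
qed

subsection \<open>Isomorphic configurations\<close>

text \<open>Naming the image configuration turns isomorphism into membership in an orbit.\<close>

definition act :: "(nat \<Rightarrow> nat) \<Rightarrow> (nat \<Rightarrow> nat) \<Rightarrow> config \<Rightarrow> config" where
  "act \<sigma> \<tau> G = Config (map_prod \<sigma> \<tau> ` one_edges G) ((`) (map_prod \<sigma> \<tau>) ` two_edges G)"

lemma isomorphic_rel_iff:
  "(G, H) \<in> isomorphic_rel m n \<longleftrightarrow> G \<in> configs m n \<and> H \<in> configs m n \<and>
    (\<exists>\<sigma> \<tau>. \<sigma> permutes {1..m} \<and> \<tau> permutes {1..n} \<and> H = act \<sigma> \<tau> G)"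
  by (cases H) (simp add: isomorphic_rel_def act_def)

lemma inj_map_prod_permutes:
  assumes "\<sigma> permutes A" "\<tau> permutes B"
  shows "inj (map_prod \<sigma> \<tau>)"
  by (intro prod.inj_map permutes_inj [OF assms(1)] permutes_inj [OF assms(2)])

lemma grid_map_prod:
  assumes "\<sigma> permutes {1..m}" "\<tau> permutes {1..n}"
  shows "map_prod \<sigma> \<tau> p \<in> grid m n \<longleftrightarrow> p \<in> grid m n"
  using permutes_in_image [OF assms(1)] permutes_in_image [OF assms(2)]
  by (cases p) (simp add: grid_def)

lemma act_configs:
  assumes "\<sigma> permutes {1..m}" "\<tau> permutes {1..n}" "G \<in> configs m n"
  shows "act \<sigma> \<tau> G \<in> configs m n"
proof -
  have sub: "map_prod \<sigma> \<tau> ` X \<subseteq> grid m n" if "X \<subseteq> grid m n" for X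
    by (rule image_subsetI) (simp add: grid_map_prod [OF assms(1,2)] subsetD [OF that])
  have "card (map_prod \<sigma> \<tau> ` X) = card X" for X
    by (intro card_image inj_on_subset [OF inj_map_prod_permutes [OF assms(1,2)]]) simp
  then show ?thesis
    using assms(3) sub by (simp add: configs_def act_def)
qed

lemma act_isomorphic:
  assumes "\<sigma> permutes {1..m}" "\<tau> permutes {1..n}" "G \<in> configs m n"
  shows "(G, act \<sigma> \<tau> G) \<in> isomorphic_rel m n"
  using assms act_configs by (auto simp: isomorphic_rel_iff)

lemma isomorphic_sym: "(G, H) \<in> isomorphic_rel m n \<Longrightarrow> (H, G) \<in> isomorphic_rel m n"
  using equiv_isomorphic_rel by (meson equivE symE)

lemma isomorphic_R_of:
  assumes "(G, H) \<in> isomorphic_rel m n"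
  shows "R_of H = R_of G" "card (one_edges H) = card (one_edges G)"
proof -
  from assms obtain \<sigma> \<tau> where *: "\<sigma> permutes {1..m}" "\<tau> permutes {1..n}" and H: "H = act \<sigma> \<tau> G"
    by (auto simp: isomorphic_rel_iff)
  note inj = inj_map_prod_permutes [OF *]
  have "inj_on ((`) (map_prod \<sigma> \<tau>)) (two_edges G)"
    using inj by (meson inj_on_def inj_image_eq_iff)
  then show "R_of H = R_of G" "card (one_edges H) = card (one_edges G)"
    using inj_on_subset [OF inj] by (simp_all add: R_of_def H act_def card_image)
qed

lemma isomorphic_simple:
  assumes "(G, H) \<in> isomorphic_rel m n" "simple_config G"
  shows "simple_config H"
proof -
  from assms obtain \<sigma> \<tau> where *: "\<sigma> permutes {1..m}" "\<tau> permutes {1..n}" and H: "H = act \<sigma> \<tau> G"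
    by (auto simp: isomorphic_rel_iff)
  have "selected_edges H = (`) (map_prod \<sigma> \<tau>) ` selected_edges G"
    by (fastforce simp: selected_edges_def H act_def image_Un)
  then show ?thesis
    using assms(2) disjoint_image [OF inj_on_subset [OF inj_map_prod_permutes [OF *]]]
    by (simp add: simple_config_def)
qed

lemma isomorphic_C4_free:
  assumes "(G, H) \<in> isomorphic_rel m n" "C4_free (one_edges G)"
  shows "C4_free (one_edges H)"
proof -
  \<comment> \<open>The inverse isomorphism carries a four-cycle in \<open>H\<close> back to one in
    \<open>G\<close>.\<close>
  have "(H, G) \<in> isomorphic_rel m n"
    using assms isomorphic_sym by blast
  then obtain \<sigma> \<tau> where *: "\<sigma> permutes {1..m}" "\<tau> permutes {1..n}" and G: "G = act \<sigma> \<tau> H"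
    by (auto simp: isomorphic_rel_iff)
  have edge: "(\<sigma> i, \<tau> j) \<in> one_edges G" if "(i, j) \<in> one_edges H" for i j
    using imageI [OF that, of "map_prod \<sigma> \<tau>"] by (simp add: G act_def)
  have neq: "\<sigma> i \<noteq> \<sigma> k" "\<tau> i \<noteq> \<tau> k" if "i \<noteq> k" for i k
    using that * by (auto dest: permutes_inj injD)
  show ?thesis
    using assms(2) edge neq unfolding C4_free_def by metis
qed

lemma isomorphic_limited:
  assumes "(G, H) \<in> isomorphic_rel m n" "limited m n G"
  shows "limited m n H"
  using assms isomorphic_simple isomorphic_C4_free isomorphic_R_of(2)
  by (auto simp: limited_def isomorphic_rel_iff)

lemma bilinear_form_permute:
  assumes "\<sigma> permutes {1..m}" "\<tau> permutes {1..n}" "bilinear_form m n f"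
  shows "bilinear_form m n (\<lambda>x y. f (x \<circ> \<sigma>) (y \<circ> \<tau>))"
proof -
  obtain c where f: "f = (\<lambda>x y. \<Sum>p\<in>grid m n. c p * u_mon p x y)"
    using assms(3) unfolding bilinear_form_def by blast
  have "bilinear_form m n (\<lambda>x y. \<Sum>p\<in>grid m n. c p * u_mon (map_prod \<sigma> \<tau> p) x y)"
    by (intro bilinear_form_sum bilinear_form_scale bilinear_form_u_mon)
      (use grid_map_prod [OF assms(1,2)] in auto)
  moreover have "u_mon (map_prod \<sigma> \<tau> p) x y = u_mon p (x \<circ> \<sigma>) (y \<circ> \<tau>)" for p x y
    by (cases p) (simp add: u_mon_def)
  ultimately show ?thesis
    by (simp add: f)
qed

text \<open>Relabelling cells amounts to permuting the variables in \<open>P_of G\<close>, and the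
  same substitution in each square keeps it the square of a bilinear form.\<close>

lemma isomorphic_is_SOS_of:
  assumes "(G, H) \<in> isomorphic_rel m n" "is_SOS_of m n (P_of G) k"
  shows "is_SOS_of m n (P_of H) k"
proof -
  from assms obtain \<sigma> \<tau> where *: "\<sigma> permutes {1..m}" "\<tau> permutes {1..n}" and H: "H = act \<sigma> \<tau> G"
    by (auto simp: isomorphic_rel_iff)
  note inj = inj_map_prod_permutes [OF *]
  have inj2: "inj_on ((`) (map_prod \<sigma> \<tau>)) (two_edges G)"
    using inj by (meson inj_on_def inj_image_eq_iff)
  have u: "u_mon (map_prod \<sigma> \<tau> p) x y = u_mon p (x \<circ> \<sigma>) (y \<circ> \<tau>)" for p x y
    by (cases p) (simp add: u_mon_def)
  have P: "P_of H x y = P_of G (x \<circ> \<sigma>) (y \<circ> \<tau>)" for x y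
    using inj_on_subset [OF inj] inj2
    by (simp add: P_of_def H act_def sum.reindex u)
  from assms(2) obtain f where f: "\<forall>t<k. bilinear_form m n (f t)"
    and PG: "P_of G = (\<lambda>x y. \<Sum>t<k. (f t x y)\<^sup>2)"
    unfolding is_SOS_of_def by blast
  show ?thesis
    unfolding is_SOS_of_def
    using f PG by (intro exI [of _ "\<lambda>t x y. f t (x \<circ> \<sigma>) (y \<circ> \<tau>)"])
      (auto simp: fun_eq_iff P intro: bilinear_form_permute [OF *])
qed

lemma isomorphic_irreducible:
  assumes "(G, H) \<in> isomorphic_rel m n" "irreducible_config m n G"
  shows "irreducible_config m n H"
proof -
  have "is_SOS_of m n (P_of G) = is_SOS_of m n (P_of H)"
    using assms(1) isomorphic_sym isomorphic_is_SOS_of by blast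
  then show ?thesis
    using assms isomorphic_R_of(1) by (simp add: irreducible_config_def SOS_def)
qed

subsection \<open>Extremal one-edge sets\<close>

text \<open>As a bipartite graph this is a theta graph: three internally disjoint paths of length
  three join row 4 to column 4, through column \<open>a\<close> and row \<open>a\<close> for
  \<open>a\<close> = 1, 2, 3.\<close>

definition extremal_cells :: "cell set" where
  "extremal_cells = {(i, j) \<in> grid 4 4. if i = 4 then j \<noteq> 4 else j = 4 \<or> j = i}"

lemma atLeastAtMost_1_4: "{1..4} = {1, 2, 3, 4 :: nat}"
  by auto

lemma grid_4_4: "grid 4 4 = {1, 2, 3, 4} \<times> {1, 2, 3, 4}"
  by (simp only: grid_def atLeastAtMost_1_4)

text \<open>The set is symmetric in the labels 1, 2, 3. Certificates stated for an arbitrary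
  labelling \<open>a, b, c\<close> therefore cover all placements of a two-edge of the same
  type.\<close>

lemma extremal_cells_eq:
  assumes "{a, b, c} = {1, 2, 3}"
  shows "extremal_cells = {(4, a), (4, b), (4, c), (a, a), (b, b), (c, c), (a, 4), (b, 4), (c, 4)}"
proof -
  have "extremal_cells = (\<lambda>j. (4, j)) ` {1, 2, 3} \<union> (\<lambda>j. (j, j)) ` {1, 2, 3} \<union> (\<lambda>j. (j, 4)) ` {1, 2, 3}"
    by (auto simp: extremal_cells_def grid_4_4)
  then show ?thesis
    unfolding assms [symmetric] by (simp only: image_insert image_empty Un_insert_left Un_empty_left)
qed

lemmas extremal_cells_123 = extremal_cells_eq [OF refl]

lemma card_extremal_cells: "card extremal_cells = 9"
  by (simp add: extremal_cells_123)

lemma C4_free_extremal_cells: "C4_free extremal_cells"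
  unfolding C4_free_def
proof (intro notI, elim exE conjE)
  fix i k j l :: nat
  assume neq: "i \<noteq> k" "j \<noteq> l"
    and mem: "(i, j) \<in> extremal_cells" "(i, l) \<in> extremal_cells" "(k, j) \<in> extremal_cells" "(k, l) \<in> extremal_cells"
  have "i \<noteq> 4 \<and> k \<noteq> 4"
    using neq mem by (auto simp: extremal_cells_def split: if_splits)
  then show False
    using neq mem by (auto simp: extremal_cells_def split: if_splits)
qed

text \<open>Two rows share at most one column, so the column pairs contained in different rows are
  disjoint families among the six pairs of four columns.\<close>

lemma C4_free_rows:
  assumes E: "E \<subseteq> grid 4 4" and free: "C4_free E"
  defines "N \<equiv> \<lambda>i. {j. (i, j) \<in> E}"
  shows "card E = (\<Sum>i\<in>{1..4}. card (N i))"
    and "(\<Sum>i\<in>{1..4}. card (N i) choose 2) \<le> 6"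
    and "\<And>i. N i \<subseteq> {1..4}"
proof -
  show N: "N i \<subseteq> {1..4}" for i
    using E by (auto simp: N_def grid_def)
  then have fin: "finite (N i)" for i
    using finite_subset by blast
  have "E = Sigma {1..4} N"
    using E by (auto simp: N_def grid_def)
  then show "card E = (\<Sum>i\<in>{1..4}. card (N i))"
    using fin by simp
  let ?Q = "\<lambda>A. {B. B \<subseteq> A \<and> card B = 2}"
  have disj: "?Q (N i) \<inter> ?Q (N k) = {}" if "i \<noteq> k" for i k
    using free that by (fastforce simp: C4_free_def card_2_iff N_def)
  have "(\<Sum>i\<in>{1..4}. card (N i) choose 2) = (\<Sum>i\<in>{1..4}. card (?Q (N i)))"
    by (simp add: n_subsets fin)
  also have "\<dots> = card (\<Union>i\<in>{1..4}. ?Q (N i))"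
    using disj fin by (intro card_UN_disjoint [symmetric]) auto
  also have "\<dots> \<le> card (?Q {1..4 :: nat})"
    using N by (intro card_mono) auto
  also have "\<dots> = 6"
    by (simp add: n_subsets choose_two)
  finally show "(\<Sum>i\<in>{1..4}. card (N i) choose 2) \<le> 6" .
qed

text \<open>The secant of \<open>d \<mapsto> d choose 2\<close> through \<open>d = 2, 3\<close> turns the pair count into a degree count.\<close>

lemma choose_two_secant:
  fixes d :: nat
  shows "2 * d \<le> (d choose 2) + 3" "2 * d = (d choose 2) + 3 \<Longrightarrow> d \<in> {2, 3}"
proof -
  have *: "d \<in> {0, 1, 2, 3, 4} \<or> 2 * d < (d choose 2) + 3"
  proof (cases "d \<le> 4")
    case False
    then obtain e where d: "d = e + 5"
      by (metis add.commute le_Suc_ex not_less_eq_eq eval_nat_numeral(3))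
    have "(d choose 2) = (e * e + 9 * e + 20) div 2"
      by (simp add: choose_two d algebra_simps)
    then show ?thesis
      using d by simp
  qed auto
  then show "2 * d \<le> (d choose 2) + 3" "2 * d = (d choose 2) + 3 \<Longrightarrow> d \<in> {2, 3}"
    by (auto simp: choose_two)
qed

lemma sum_1_4: "(\<Sum>i\<in>{1..4}. f i) = f 1 + f 2 + f 3 + (f 4 :: nat)" for f :: "nat \<Rightarrow> nat"
  by (simp add: numeral_eq_Suc)

text \<open>Summing the secant bound over four rows gives at most 6 + 12 = 18 for twice the number
  of cells.\<close>

lemma card_C4_free_le:
  assumes "E \<subseteq> grid 4 4" "C4_free E"
  shows "card E \<le> 9"
proof -
  note rows = C4_free_rows [OF assms]
  have "2 * card E \<le> (\<Sum>i\<in>{1..4}. (card {j. (i, j) \<in> E} choose 2) + 3)"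
    unfolding rows(1) sum_distrib_left by (intro sum_mono choose_two_secant)
  then show ?thesis
    using rows(2) by (simp add: sum.distrib)
qed

lemma zarankiewicz_4_4: "zarankiewicz 4 4 = 9"
  unfolding zarankiewicz_def
proof (rule Max_eqI)
  have "{E. E \<subseteq> grid 4 4 \<and> C4_free E} \<subseteq> Pow (grid 4 4)"
    by auto
  then show "finite (card ` {E. E \<subseteq> grid 4 4 \<and> C4_free E})"
    by (auto intro: finite_subset)
  show "9 \<in> card ` {E. E \<subseteq> grid 4 4 \<and> C4_free E}"
    using card_extremal_cells C4_free_extremal_cells
    by (intro image_eqI [of _ _ extremal_cells]) (auto simp: extremal_cells_def)
qed (use card_C4_free_le in auto)

lemma C4_free_9_rows:
  assumes "E \<subseteq> grid 4 4" "C4_free E" "card E = 9"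
  obtains r where "r \<in> {1..4}" "card {j. (r, j) \<in> E} = 3"
    "\<And>i. i \<in> {1..4} - {r} \<Longrightarrow> card {j. (i, j) \<in> E} = 2"
proof -
  define d where "d i = card {j. (i, j) \<in> E}" for i
  note rows = C4_free_rows [OF assms(1,2), folded d_def]
  have sum: "d 1 + d 2 + d 3 + d 4 = 9"
    using rows(1) assms(3) sum_1_4 by metis
  have "(d 1 choose 2) + (d 2 choose 2) + (d 3 choose 2) + (d 4 choose 2) \<le> 6"
    using rows(2) unfolding sum_1_4 .
  \<comment> \<open>Nine cells attain the bound 18, so the secant inequality is an equality in every
    row. All degrees are then 2 or 3, and the sum 9 leaves exactly one 3.\<close>
  then have "2 * d i = (d i choose 2) + 3" if "i \<in> {1, 2, 3, 4}" for i
    using sum that choose_two_secant(1) [of "d 1"] choose_two_secant(1) [of "d 2"]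
      choose_two_secant(1) [of "d 3"] choose_two_secant(1) [of "d 4"] by auto
  then have range: "d i \<in> {2, 3}" if "i \<in> {1, 2, 3, 4}" for i
    using choose_two_secant(2) that by blast
  have "\<exists>r\<in>{1, 2, 3, 4}. d r = 3 \<and> (\<forall>i\<in>{1, 2, 3, 4} - {r}. d i = 2)"
    using range [of 1] range [of 2] range [of 3] range [of 4] sum by auto
  then show ?thesis
    using that unfolding d_def atLeastAtMost_1_4 by blast
qed

text \<open>The row \<open>r\<close> with three cells misses one column \<open>c\<close>. Every
  other row has two cells, at most one of them in a column of \<open>r\<close>, so it contains
  \<open>c\<close> and one further column \<open>f i\<close>. No two rows can share both, hence
  \<open>f\<close> is injective and the theta graph appears.\<close>

lemma C4_free_9_isomorphic:
  assumes E: "E \<subseteq> grid 4 4" and free: "C4_free E" and card: "card E = 9"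
  obtains \<sigma> \<tau> where "\<sigma> permutes {1..4}" "\<tau> permutes {1..4}" "E = map_prod \<sigma> \<tau> ` extremal_cells"
proof -
  obtain r where r: "r \<in> {1..4}" and row_r: "card {j. (r, j) \<in> E} = 3"
    and row: "\<And>i. i \<in> {1..4} - {r} \<Longrightarrow> card {j. (i, j) \<in> E} = 2"
    using C4_free_9_rows [OF assms] by blast
  define N where "N i = {j. (i, j) \<in> E}" for i
  have N: "N i \<subseteq> {1..4}" "finite (N i)" for i
    using C4_free_rows(3) [OF E free] finite_subset unfolding N_def by blast+
  have N_inter: False if "i \<noteq> k" "j \<noteq> l" "{j, l} \<subseteq> N i" "{j, l} \<subseteq> N k" for i k j l
    using free that unfolding C4_free_def N_def by blast
  have "card ({1..4} - N r) = 1"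
    using row_r N [of r] by (simp add: card_Diff_subset N_def)
  then obtain c where c: "{1..4} - N r = {c}"
    by (auto simp: card_1_singleton_iff)
  have "\<exists>j. N i = {c, j} \<and> j \<noteq> c" if i: "i \<in> {1..4} - {r}" for i
  proof -
    obtain j l where jl: "N i = {j, l}" "j \<noteq> l"
      using row [OF i] by (auto simp: N_def card_2_iff)
    then have "j \<notin> N r \<or> l \<notin> N r"
      using N_inter [of i r j l] i by auto
    then have "j = c \<or> l = c"
      using c N(1) [of i] jl by auto
    then show ?thesis
      using jl by auto
  qed
  then obtain f where f: "\<And>i. i \<in> {1..4} - {r} \<Longrightarrow> N i = {c, f i} \<and> f i \<noteq> c"
    by metis
  have f_inj: "i = k" if "i \<in> {1..4} - {r}" "k \<in> {1..4} - {r}" "f i = f k" for i k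
    using N_inter [of i k c "f i"] f [OF that(1)] f [OF that(2)] that(3) by auto
  have f_range: "f i \<in> N r" if "i \<in> {1..4} - {r}" for i
    using f [OF that] N(1) [of i] c by auto
  define \<sigma> where "\<sigma> = transpose 4 r"
  have \<sigma>: "\<sigma> permutes {1..4}"
    using r unfolding \<sigma>_def by (intro permutes_swap_id) auto
  have \<sigma>4: "\<sigma> 4 = r"
    by (simp add: \<sigma>_def)
  have \<sigma>_range: "\<sigma> a \<in> {1..4} - {r}" if "a \<in> {1..3}" for a
  proof -
    have "\<sigma> a \<noteq> \<sigma> 4"
      using that permutes_inj [OF \<sigma>] by (simp add: inj_eq)
    then show ?thesis
      using that permutes_in_image [OF \<sigma>, of a] \<sigma>4 by simp
  qed
  \<comment> \<open>Column 4 goes to the missed column \<open>c\<close>, and column \<open>a\<close>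
    to the second column of the row that replaces row \<open>a\<close>; the last branch keeps the
    map the identity outside the grid.\<close>
  define \<tau> where "\<tau> a = (if a \<in> {1..3} then f (\<sigma> a) else if a = 4 then c else a)" for a
  have inj: "inj_on \<tau> {1..4}"
  proof (rule inj_onI)
    fix a b :: nat
    assume ab: "a \<in> {1..4}" "b \<in> {1..4}" "\<tau> a = \<tau> b"
    have four: "x = 4 \<or> x \<in> {1..3}" if "x \<in> {1..4}" for x :: nat
      using that by auto
    have "\<tau> x \<noteq> c" if "x \<in> {1..3}" for x
      using f [OF \<sigma>_range [OF that]] that by (simp add: \<tau>_def)
    moreover have "\<tau> 4 = c"
      by (simp add: \<tau>_def)
    moreover have "a = b" if "a \<in> {1..3}" "b \<in> {1..3}"
    proof -
      have "\<sigma> a = \<sigma> b"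
        using f_inj [OF \<sigma>_range [OF that(1)] \<sigma>_range [OF that(2)]] ab(3) that by (simp add: \<tau>_def)
      then show ?thesis
        using permutes_inj [OF \<sigma>] by (simp add: inj_eq)
    qed
    ultimately show "a = b"
      using four [OF ab(1)] four [OF ab(2)] ab(3) by metis
  qed
  have "\<tau> a \<in> {1..4}" if "a \<in> {1..4}" for a
  proof (cases "a \<in> {1..3}")
    case True
    then show ?thesis
      using subsetD [OF N(1) f_range [OF \<sigma>_range [OF True]]] by (simp add: \<tau>_def)
  next
    case False
    moreover have "c \<in> {1..4}"
      using c by blast
    ultimately show ?thesis
      using that by (simp add: \<tau>_def)
  qed
  then have "\<tau> ` {1..4} \<subseteq> {1..4}"
    by (rule image_subsetI)
  from endo_inj_surj [OF _ this inj] inj have "bij_betw \<tau> {1..4} {1..4}"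
    by (simp add: bij_betw_def)
  then have \<tau>: "\<tau> permutes {1..4}"
    by (rule bij_imp_permutes) (auto simp: \<tau>_def)
  have "map_prod \<sigma> \<tau> ` extremal_cells \<subseteq> E"
  proof (rule image_subsetI)
    fix p
    assume "p \<in> extremal_cells"
    then obtain i j where p: "p = (i, j)" and "(i, j) \<in> extremal_cells"
      by (cases p) simp
    then consider "i = 4" "j \<in> {1..3}" | "i \<in> {1..3}" "j = 4" | "i \<in> {1..3}" "j = i"
      by (auto simp: extremal_cells_123)
    then have "\<tau> j \<in> N (\<sigma> i)"
    proof cases
      case 1
      then show ?thesis
        using f_range [OF \<sigma>_range [OF 1(2)]] by (simp add: \<sigma>4 \<tau>_def)
    next
      case 2
      then show ?thesis
        using f [OF \<sigma>_range [OF 2(1)]] by (simp add: \<tau>_def)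
    next
      case 3
      then show ?thesis
        using f [OF \<sigma>_range [OF 3(1)]] by (simp add: \<tau>_def)
    qed
    then show "map_prod \<sigma> \<tau> p \<in> E"
      by (simp add: N_def p)
  qed
  \<comment> \<open>Both sets have nine cells, so the inclusion is an equality.\<close>
  moreover have "card (map_prod \<sigma> \<tau> ` extremal_cells) = card E"
    using inj_on_subset [OF inj_map_prod_permutes [OF \<sigma> \<tau>]]
    by (simp add: card_image card card_extremal_cells)
  moreover have "finite E"
    using E finite_subset finite_grid by blast
  ultimately have "map_prod \<sigma> \<tau> ` extremal_cells = E"
    by (metis card_subset_eq)
  then show ?thesis
    using that \<sigma> \<tau> by blast
qed

subsection \<open>Reducible configurations\<close>

lemma labelling:
  assumes "{a, b, c} = {1, 2, 3 :: nat}"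
  shows "a \<noteq> b" "a \<noteq> c" "b \<noteq> c" "b \<noteq> a" "c \<noteq> a" "c \<noteq> b"
    "a \<in> {1..3}" "b \<in> {1..3}" "c \<in> {1..3}"
proof -
  have "card {a, b, c} = 3"
    unfolding assms by simp
  then show "a \<noteq> b" "a \<noteq> c" "b \<noteq> c" "b \<noteq> a" "c \<noteq> a" "c \<noteq> b"
    by (auto simp: card_insert_if split: if_splits)
  have "{a, b, c} \<subseteq> {1..3}"
    unfolding assms by simp
  then show "a \<in> {1..3}" "b \<in> {1..3}" "c \<in> {1..3}"
    by blast+
qed

lemma labelling_neq_4:
  assumes "{a, b, c} = {1, 2, 3 :: nat}"
  shows "a \<noteq> 4" "b \<noteq> 4" "c \<noteq> 4" "4 \<noteq> a" "4 \<noteq> b" "4 \<noteq> c"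
  using labelling(7-9) [OF assms] by auto

lemma labelling_range:
  assumes "{a, b, c} = {1, 2, 3 :: nat}"
  shows "a \<in> {1..4}" "b \<in> {1..4}" "c \<in> {1..4}" "4 \<in> {1..4 :: nat}"
  using labelling(7-9) [OF assms] by auto

lemma P_of_extremal:
  assumes "{a, b, c} = {1, 2, 3}"
  shows "P_of (Config extremal_cells F) x y =
    (x 4 * y a)\<^sup>2 + (x 4 * y b)\<^sup>2 + (x 4 * y c)\<^sup>2 +
    (x a * y a)\<^sup>2 + (x b * y b)\<^sup>2 + (x c * y c)\<^sup>2 +
    (x a * y 4)\<^sup>2 + (x b * y 4)\<^sup>2 + (x c * y 4)\<^sup>2 +
    (\<Sum>e\<in>F. (\<Sum>p\<in>e. u_mon p x y)\<^sup>2)"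
  using labelling [OF assms] labelling_neq_4 [OF assms]
  by (simp add: P_of_def extremal_cells_eq [OF assms] u_mon_def)

lemma is_SOS_ofI:
  assumes "\<And>x y. P x y = (\<Sum>(w, f)\<leftarrow>ws. w * (f x y)\<^sup>2)"
    and "list_all (\<lambda>(w, f). w \<ge> 0 \<and> bilinear_form m n f) ws" and "k = length ws"
  shows "is_SOS_of m n P k"
proof -
  have "P = (\<lambda>x y. \<Sum>(w, f)\<leftarrow>ws. w * (f x y)\<^sup>2)"
    using assms(1) by (intro ext)
  then show ?thesis
    using is_SOS_of_list [of ws m n] assms(2,3) by (auto simp: list_all_iff)
qed

lemmas bilinear_intros = conjI TrueI bilinear_form_monomial bilinear_form_add bilinear_form_diff bilinear_form_scale

text \<open>
  Where \<open>half_root\<close> occurs below, the sum of the listed squares exceeds \<open>P\<^sub>G\<close> by a multiple of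
  \<open>2 * half_root\<^sup>2 - 1\<close>, which leaves an identity of polynomials in \<open>half_root\<close>.
\<close>

definition half_root :: real where
  "half_root = sqrt (1 / 2)"

lemma half_root_square: "2 * half_root\<^sup>2 - 1 = 0"
  by (simp add: half_root_def)

text \<open>Needed for the nonnegativity of the weight \<open>2 * half_root - 1\<close> in the
  certificates with a common row or column.\<close>

lemma half_root_ge: "2 * half_root - 1 \<ge> 0"
proof -
  have "1 / 2 \<le> half_root"
    unfolding half_root_def by (intro real_le_rsqrt) (simp add: power2_eq_square)
  then show ?thesis
    by simp
qed

text \<open>The square of the cell \<open>(a, a)\<close> is shared equally between
  \<open>(4, b)\<close> and \<open>(4, c)\<close>. The new cross terms cancel over the rectangles
  with rows 4, \<open>a\<close> and columns \<open>a, b\<close> or \<open>a, c\<close>, so five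
  squares become four.\<close>

lemma is_SOS_row:
  assumes "{a, b, c} = {1, 2, 3}"
  shows "is_SOS_of 4 4 (P_of (Config extremal_cells {{(a, b), (a, c)}})) 9"
proof (rule is_SOS_ofI)
  let ?h = half_root
  let ?ws = "[(1, \<lambda>x y. x 4 * y b + ?h * (x a * y a)), (1, \<lambda>x y. x 4 * y c + ?h * (x a * y a)),
    (1, \<lambda>x y. x 4 * y a - ?h * (x a * y b + x a * y c)), (1 / 2, \<lambda>x y. x a * y b + x a * y c),
    (1, \<lambda>x y. x b * y b), (1, \<lambda>x y. x c * y c),
    (1, \<lambda>x y. x a * y 4), (1, \<lambda>x y. x b * y 4), (1, \<lambda>x y. x c * y 4)] :: (real \<times> form) list"
  show "list_all (\<lambda>(w, f). w \<ge> 0 \<and> bilinear_form 4 4 f) ?ws"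
    unfolding list.pred_inject prod.case
    by (intro bilinear_intros) (use labelling_range [OF assms] in simp_all)
  fix x y :: "nat \<Rightarrow> real"
  have "(\<Sum>(w, f)\<leftarrow>?ws. w * (f x y)\<^sup>2) = P_of (Config extremal_cells {{(a, b), (a, c)}}) x y +
      (2 * ?h\<^sup>2 - 1) * ((x a * y a)\<^sup>2 + 1 / 2 * (x a * y b + x a * y c)\<^sup>2)"
    using labelling [OF assms] by (simp add: P_of_extremal [OF assms] u_mon_def)
      (simp add: power2_eq_square field_simps)
  then show "P_of (Config extremal_cells {{(a, b), (a, c)}}) x y = (\<Sum>(w, f)\<leftarrow>?ws. w * (f x y)\<^sup>2)"
    unfolding half_root_square by simp
qed simp

text \<open>The transpose of the certificate in \<open>is_SOS_row\<close>.\<close>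

lemma is_SOS_column:
  assumes "{a, b, c} = {1, 2, 3}"
  shows "is_SOS_of 4 4 (P_of (Config extremal_cells {{(b, a), (c, a)}})) 9"
proof (rule is_SOS_ofI)
  let ?h = half_root
  let ?ws = "[(1, \<lambda>x y. x b * y 4 + ?h * (x a * y a)), (1, \<lambda>x y. x c * y 4 + ?h * (x a * y a)),
    (1, \<lambda>x y. x a * y 4 - ?h * (x b * y a + x c * y a)), (1 / 2, \<lambda>x y. x b * y a + x c * y a),
    (1, \<lambda>x y. x b * y b), (1, \<lambda>x y. x c * y c),
    (1, \<lambda>x y. x 4 * y a), (1, \<lambda>x y. x 4 * y b), (1, \<lambda>x y. x 4 * y c)] :: (real \<times> form) list"
  show "list_all (\<lambda>(w, f). w \<ge> 0 \<and> bilinear_form 4 4 f) ?ws"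
    unfolding list.pred_inject prod.case
    by (intro bilinear_intros) (use labelling_range [OF assms] in simp_all)
  fix x y :: "nat \<Rightarrow> real"
  have "(\<Sum>(w, f)\<leftarrow>?ws. w * (f x y)\<^sup>2) = P_of (Config extremal_cells {{(b, a), (c, a)}}) x y +
      (2 * ?h\<^sup>2 - 1) * ((x a * y a)\<^sup>2 + 1 / 2 * (x b * y a + x c * y a)\<^sup>2)"
    using labelling [OF assms] by (simp add: P_of_extremal [OF assms] u_mon_def)
      (simp add: power2_eq_square field_simps)
  then show "P_of (Config extremal_cells {{(b, a), (c, a)}}) x y = (\<Sum>(w, f)\<leftarrow>?ws. w * (f x y)\<^sup>2)"
    unfolding half_root_square by simp
qed simp

text \<open>The cross term of the two-edge moves to the opposite diagonal \<open>(4, b)\<close>,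
  \<open>(a, 4)\<close>, merging two one-edges. The freed cell \<open>(4, 4)\<close> merges with
  \<open>(c, c)\<close>, compensated by merging \<open>(4, c)\<close> with \<open>(c, 4)\<close>.
  Two squares are saved.\<close>

lemma is_SOS_corner:
  assumes "{a, b, c} = {1, 2, 3}"
  shows "is_SOS_of 4 4 (P_of (Config extremal_cells {{(4, 4), (a, b)}})) 8"
proof (rule is_SOS_ofI)
  let ?ws = "[(1, \<lambda>x y. x 4 * y 4 - x c * y c), (1, \<lambda>x y. x 4 * y c + x c * y 4),
    (1, \<lambda>x y. x 4 * y b + x a * y 4), (1, \<lambda>x y. x a * y b), (1, \<lambda>x y. x a * y a),
    (1, \<lambda>x y. x b * y b), (1, \<lambda>x y. x 4 * y a), (1, \<lambda>x y. x b * y 4)] :: (real \<times> form) list"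
  show "list_all (\<lambda>(w, f). w \<ge> 0 \<and> bilinear_form 4 4 f) ?ws"
    unfolding list.pred_inject prod.case
    by (intro bilinear_intros) (use labelling_range [OF assms] in simp_all)
  fix x y :: "nat \<Rightarrow> real"
  show "P_of (Config extremal_cells {{(4, 4), (a, b)}}) x y = (\<Sum>(w, f)\<leftarrow>?ws. w * (f x y)\<^sup>2)"
    using labelling [OF assms] labelling_neq_4 [OF assms]
    by (simp add: P_of_extremal [OF assms] u_mon_def)
      (simp add: power2_eq_square field_simps)
qed simp

text \<open>
  Splitting into symmetric and antisymmetric combinations under \<open>a \<leftrightarrow> b\<close> blocks the Gram matrix;
  with all free entries equal to \<open>1/2\<close> the antisymmetric block has corank two.
\<close>

lemma is_SOS_transposed:
  assumes "{a, b, c} = {1, 2, 3}"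
  shows "is_SOS_of 4 4 (P_of (Config extremal_cells {{(a, b), (b, a)}})) 9"
proof (rule is_SOS_ofI)
  \<comment> \<open>The first two squares are the antisymmetric block, the next four the symmetric
    block, and the last three are untouched one-edges.\<close>
  let ?ws = "[
    (1 / 2, \<lambda>x y. x 4 * y a - x 4 * y b - 1 / 2 * (x a * y b - x b * y a) - 1 / 2 * (x a * y a - x b * y b)),
    (1 / 2, \<lambda>x y. x a * y 4 - x b * y 4 + 1 / 2 * (x a * y b - x b * y a) - 1 / 2 * (x a * y a - x b * y b)),
    (1 / 2, \<lambda>x y. x 4 * y a + x 4 * y b - 1 / 2 * (x a * y b + x b * y a) + 1 / 2 * (x a * y a + x b * y b)),
    (1 / 2, \<lambda>x y. x a * y 4 + x b * y 4 - 1 / 2 * (x a * y b + x b * y a) + 1 / 2 * (x a * y a + x b * y b)),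
    (1 / 2, \<lambda>x y. x a * y b + x b * y a + 1 / 2 * (x a * y a + x b * y b)),
    (3 / 8, \<lambda>x y. x a * y a + x b * y b),
    (1, \<lambda>x y. x 4 * y c), (1, \<lambda>x y. x c * y c), (1, \<lambda>x y. x c * y 4)] :: (real \<times> form) list"
  show "list_all (\<lambda>(w, f). w \<ge> 0 \<and> bilinear_form 4 4 f) ?ws"
    unfolding list.pred_inject prod.case
    by (intro bilinear_intros) (use labelling_range [OF assms] in simp_all)
  fix x y :: "nat \<Rightarrow> real"
  show "P_of (Config extremal_cells {{(a, b), (b, a)}}) x y = (\<Sum>(w, f)\<leftarrow>?ws. w * (f x y)\<^sup>2)"
    using labelling [OF assms]
    by (simp add: P_of_extremal [OF assms] u_mon_def)
      (simp add: power2_eq_square field_simps)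
qed simp

text \<open>Cross terms cancel over three rectangles: rows 4, \<open>a\<close> with columns
  \<open>a, b\<close>, rows 4, \<open>c\<close> with columns \<open>b, c\<close>, and rows 4,
  \<open>b\<close> with columns \<open>a, c\<close>. The two-edges and five one-edges then need six
  squares instead of seven.\<close>

lemma is_SOS_opposite_paths:
  assumes "{a, b, c} = {1, 2, 3}"
  shows "is_SOS_of 4 4 (P_of (Config extremal_cells {{(a, b), (b, c)}, {(c, b), (b, a)}})) 10"
proof (rule is_SOS_ofI)
  let ?h = half_root
  let ?ws = "[(1, \<lambda>x y. x a * y b + x b * y c - ?h * (x 4 * y a)), (1 / 2, \<lambda>x y. x 4 * y a),
    (1, \<lambda>x y. x c * y b + x b * y a + ?h * (x 4 * y c)), (1 / 2, \<lambda>x y. x 4 * y c),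
    (1, \<lambda>x y. x 4 * y b + ?h * (x a * y a - x c * y c)), (1 / 2, \<lambda>x y. x a * y a + x c * y c),
    (1, \<lambda>x y. x b * y b), (1, \<lambda>x y. x a * y 4), (1, \<lambda>x y. x b * y 4), (1, \<lambda>x y. x c * y 4)] :: (real \<times> form) list"
  show "list_all (\<lambda>(w, f). w \<ge> 0 \<and> bilinear_form 4 4 f) ?ws"
    unfolding list.pred_inject prod.case
    by (intro bilinear_intros) (use labelling_range [OF assms] in simp_all)
  fix x y :: "nat \<Rightarrow> real"
  have "(\<Sum>(w, f)\<leftarrow>?ws. w * (f x y)\<^sup>2) = P_of (Config extremal_cells {{(a, b), (b, c)}, {(c, b), (b, a)}}) x y +
      (2 * ?h\<^sup>2 - 1) * (1 / 2 * ((x 4 * y a)\<^sup>2 + (x 4 * y c)\<^sup>2 + (x a * y a - x c * y c)\<^sup>2))"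
    using labelling [OF assms] by (simp add: P_of_extremal [OF assms] u_mon_def doubleton_eq_iff)
      (simp add: power2_eq_square field_simps)
  then show "P_of (Config extremal_cells {{(a, b), (b, c)}, {(c, b), (b, a)}}) x y =
      (\<Sum>(w, f)\<leftarrow>?ws. w * (f x y)\<^sup>2)"
    unfolding half_root_square by simp
qed simp

text \<open>Each two-edge has a half in row \<open>a\<close>. Its cross term is divided between the
  two diagonals of its rectangle in the proportion \<open>half_root\<close> to
  \<open>1 - half_root\<close>; the weight of the fifth square restores the norms because \<open>(1
  - half_root)\<^sup>2 + (2 * half_root - 1) = half_root\<^sup>2\<close>.\<close>

lemma is_SOS_common_row:
  assumes "{a, b, c} = {1, 2, 3}"
  shows "is_SOS_of 4 4 (P_of (Config extremal_cells {{(a, b), (b, c)}, {(a, c), (c, b)}})) 10"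
proof (rule is_SOS_ofI)
  let ?h = half_root
  let ?ws = "[(1, \<lambda>x y. x 4 * y b + ?h * (x b * y c - x c * y c)),
    (1, \<lambda>x y. x 4 * y c + ?h * (x c * y b - x b * y b)),
    (1, \<lambda>x y. x a * y b + (1 - ?h) * (x b * y c + x c * y c)),
    (1, \<lambda>x y. x a * y c + ?h * (x b * y b + x c * y b)),
    (2 * ?h - 1, \<lambda>x y. x b * y c + x c * y c),
    (1, \<lambda>x y. x a * y a), (1, \<lambda>x y. x 4 * y a), (1, \<lambda>x y. x a * y 4), (1, \<lambda>x y. x b * y 4),
    (1, \<lambda>x y. x c * y 4)] :: (real \<times> form) list"
  show "list_all (\<lambda>(w, f). w \<ge> 0 \<and> bilinear_form 4 4 f) ?ws"
    unfolding list.pred_inject prod.case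
    by (intro bilinear_intros) (use labelling_range [OF assms] half_root_ge in simp_all)
  fix x y :: "nat \<Rightarrow> real"
  have "(\<Sum>(w, f)\<leftarrow>?ws. w * (f x y)\<^sup>2) = P_of (Config extremal_cells {{(a, b), (b, c)}, {(a, c), (c, b)}}) x y +
      (2 * ?h\<^sup>2 - 1) * (1 / 2 * ((x b * y c - x c * y c)\<^sup>2 + (x c * y b - x b * y b)\<^sup>2 +
        (x b * y b + x c * y b)\<^sup>2 + (x b * y c + x c * y c)\<^sup>2))"
    using labelling [OF assms] by (simp add: P_of_extremal [OF assms] u_mon_def doubleton_eq_iff)
      (simp add: power2_eq_square field_simps)
  then show "P_of (Config extremal_cells {{(a, b), (b, c)}, {(a, c), (c, b)}}) x y =
      (\<Sum>(w, f)\<leftarrow>?ws. w * (f x y)\<^sup>2)"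
    unfolding half_root_square by simp
qed simp

text \<open>The transpose of the certificate in \<open>is_SOS_common_row\<close>.\<close>

lemma is_SOS_common_column:
  assumes "{a, b, c} = {1, 2, 3}"
  shows "is_SOS_of 4 4 (P_of (Config extremal_cells {{(c, b), (b, a)}, {(b, c), (c, a)}})) 10"
proof (rule is_SOS_ofI)
  let ?h = half_root
  let ?ws = "[(1, \<lambda>x y. x b * y 4 + ?h * (x c * y b - x c * y c)),
    (1, \<lambda>x y. x c * y 4 + ?h * (x b * y c - x b * y b)),
    (1, \<lambda>x y. x b * y a + (1 - ?h) * (x c * y b + x c * y c)),
    (1, \<lambda>x y. x c * y a + ?h * (x b * y b + x b * y c)),
    (2 * ?h - 1, \<lambda>x y. x c * y b + x c * y c),
    (1, \<lambda>x y. x a * y a), (1, \<lambda>x y. x 4 * y a), (1, \<lambda>x y. x a * y 4), (1, \<lambda>x y. x 4 * y b),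
    (1, \<lambda>x y. x 4 * y c)] :: (real \<times> form) list"
  show "list_all (\<lambda>(w, f). w \<ge> 0 \<and> bilinear_form 4 4 f) ?ws"
    unfolding list.pred_inject prod.case
    by (intro bilinear_intros) (use labelling_range [OF assms] half_root_ge in simp_all)
  fix x y :: "nat \<Rightarrow> real"
  have "(\<Sum>(w, f)\<leftarrow>?ws. w * (f x y)\<^sup>2) = P_of (Config extremal_cells {{(c, b), (b, a)}, {(b, c), (c, a)}}) x y +
      (2 * ?h\<^sup>2 - 1) * (1 / 2 * ((x c * y b - x c * y c)\<^sup>2 + (x b * y c - x b * y b)\<^sup>2 +
        (x b * y b + x b * y c)\<^sup>2 + (x c * y b + x c * y c)\<^sup>2))"
    using labelling [OF assms] by (simp add: P_of_extremal [OF assms] u_mon_def doubleton_eq_iff)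
      (simp add: power2_eq_square field_simps)
  then show "P_of (Config extremal_cells {{(c, b), (b, a)}, {(b, c), (c, a)}}) x y =
      (\<Sum>(w, f)\<leftarrow>?ws. w * (f x y)\<^sup>2)"
    unfolding half_root_square by simp
qed simp

subsection \<open>The irreducible class\<close>

lemma complement_cases:
  assumes "p \<in> grid 4 4" "p \<notin> extremal_cells"
  obtains "p = (4, 4)" | a b c where "{a, b, c} = {1, 2, 3}" "p = (a, b)"
proof -
  have "p = (4, 4) \<or> p \<in> {(1, 2), (1, 3), (2, 1), (2, 3), (3, 1), (3, 2)}"
    using assms by (auto simp: grid_4_4 extremal_cells_123)
  moreover have "{1, 2, 3} = {1, 2, 3 :: nat}" "{1, 3, 2} = {1, 2, 3 :: nat}" "{2, 1, 3} = {1, 2, 3 :: nat}"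
    "{2, 3, 1} = {1, 2, 3 :: nat}" "{3, 1, 2} = {1, 2, 3 :: nat}" "{3, 2, 1} = {1, 2, 3 :: nat}"
    by auto
  ultimately show thesis
    using that by blast
qed

lemma labelling_permute:
  assumes "{a, b, c} = {1, 2, 3 :: nat}"
  shows "{a, c, b} = {1, 2, 3}" "{b, a, c} = {1, 2, 3}" "{b, c, a} = {1, 2, 3}"
    "{c, a, b} = {1, 2, 3}" "{c, b, a} = {1, 2, 3}"
  unfolding assms [symmetric] by (simp_all add: insert_commute)

lemma limited_config:
  assumes "limited m n G"
  shows "G \<in> configs m n" "simple_config G"
  using assms by (simp_all add: limited_def)

context
  fixes G :: config
  assumes limited: "limited 4 4 G" and irreducible: "irreducible_config 4 4 G"
    and extremal: "one_edges G = extremal_cells"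
begin

private lemmas config = limited_config(1) [OF limited]
private lemmas simple = limited_config(2) [OF limited]

text \<open>Turns each certificate into the exclusion of its two-edges from \<open>G\<close>: the
  nine one-edges and \<open>F\<close> display \<open>9 + card F\<close> squares.\<close>

lemma no_short_SOS:
  assumes "F \<subseteq> two_edges G" "is_SOS_of 4 4 (P_of (Config extremal_cells F)) k" "k < 9 + card F"
  shows False
  using not_irreducibleI [OF config assms(1)] assms(2,3) irreducible
  by (simp add: extremal card_extremal_cells)

lemma two_edge_cells:
  assumes "e \<in> two_edges G"
  obtains p q where "e = {p, q}" "p \<noteq> q" "p \<in> grid 4 4" "q \<in> grid 4 4"
    "p \<notin> extremal_cells" "q \<notin> extremal_cells"
proof -
  have e: "e \<subseteq> grid 4 4" "card e = 2"
    using assms config by (auto simp: configs_def)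
  then obtain p q where pq: "e = {p, q}" "p \<noteq> q"
    by (auto simp: card_2_iff)
  have "r \<notin> extremal_cells" if "r \<in> e" for r
  proof
    assume "r \<in> extremal_cells"
    then have "{r} \<in> selected_edges G"
      unfolding selected_edges_def extremal by blast
    moreover have "e \<in> selected_edges G"
      using assms by (simp add: selected_edges_def)
    ultimately have "{r} = e"
      using edge_eq [OF simple] that by blast
    then show False
      using e(2) by auto
  qed
  then show thesis
    using that pq e(1) by blast
qed

lemma no_corner_edge:
  assumes "{(4, 4), p} \<in> two_edges G" "p \<noteq> (4, 4)" "p \<in> grid 4 4" "p \<notin> extremal_cells"
  shows False
  using assms(3,4)
proof (cases rule: complement_cases)
  case (2 a b c)
  show False
    by (rule no_short_SOS [OF _ is_SOS_corner [OF 2(1)]]) (use assms 2 in simp_all)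
qed (use assms in simp)

text \<open>With one half at \<open>(a, b)\<close>, the other half has five positions left. Three
  are excluded by certificates; \<open>(b, c)\<close> and \<open>(c, a)\<close> are the same type,
  read forwards and backwards.\<close>

lemma two_edge_path:
  assumes e: "e \<in> two_edges G"
  obtains a b c where "{a, b, c} = {1, 2, 3}" "e = {(a, b), (b, c)}"
proof -
  obtain p q where pq: "e = {p, q}" "p \<noteq> q" and p: "p \<in> grid 4 4" "p \<notin> extremal_cells"
    and q: "q \<in> grid 4 4" "q \<notin> extremal_cells"
    using two_edge_cells [OF e] by metis
  have "p \<noteq> (4, 4)" "q \<noteq> (4, 4)"
    using no_corner_edge [of q] no_corner_edge [of p] e pq p q by (auto simp: insert_commute)
  then obtain a b c where abc: "{a, b, c} = {1, 2, 3}" and p_eq: "p = (a, b)"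
    using complement_cases [OF p] by metis
  obtain a' b' c' where abc': "{a', b', c'} = {1, 2, 3}" and q_eq: "q = (a', b')"
    using complement_cases [OF q] \<open>q \<noteq> (4, 4)\<close> by metis
  note perms = labelling_permute [OF abc]
  have "a' \<in> {a, b, c}" "b' \<in> {a, b, c}" "a' \<noteq> b'"
    using labelling(1) [OF abc'] abc' unfolding abc by blast+
  then consider "q = (a, c)" | "q = (b, a)" | "q = (b, c)" | "q = (c, a)" | "q = (c, b)"
    using pq(2) unfolding p_eq q_eq by blast
  then show thesis
  proof cases
    case 1
    then have False
      by (intro no_short_SOS [OF _ is_SOS_row [OF abc]]) (use e pq p_eq in auto)
    then show thesis ..
  next
    case 2
    then have False
      by (intro no_short_SOS [OF _ is_SOS_transposed [OF abc]]) (use e pq p_eq in auto)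
    then show thesis ..
  next
    case 3
    then show thesis
      using that [OF abc] pq p_eq by simp
  next
    case 4
    then show thesis
      using that [OF perms(4)] pq p_eq by (simp add: insert_commute)
  next
    case 5
    then have False
      by (intro no_short_SOS [OF _ is_SOS_column [OF perms(2)]]) (use e pq p_eq in auto)
    then show thesis ..
  qed
qed

lemma two_edges_unique:
  assumes e: "e \<in> two_edges G" and f: "f \<in> two_edges G"
  shows "e = f"
proof (rule ccontr)
  assume neq: "e \<noteq> f"
  have disj: "e \<inter> f = {}"
  proof -
    have "e \<in> selected_edges G" "f \<in> selected_edges G"
      using e f by (simp_all add: selected_edges_def)
    then show ?thesis
      using edge_eq [OF simple, of e f] neq by blast
  qed
  obtain a b c where abc: "{a, b, c} = {1, 2, 3}" and e_eq: "e = {(a, b), (b, c)}"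
    using two_edge_path [OF e] .
  obtain x y z where xyz: "{x, y, z} = {1, 2, 3}" and f_eq: "f = {(x, y), (y, z)}"
    using two_edge_path [OF f] .
  note perms = labelling_permute [OF abc]
  have "x \<in> {a, b, c}" "y \<in> {a, b, c}" "z \<in> {a, b, c}" "x \<noteq> y" "x \<noteq> z" "y \<noteq> z"
    using labelling [OF xyz] xyz unfolding abc by blast+
  \<comment> \<open>Of the six labellings of \<open>f\<close>, the three cyclic rotations of
    \<open>a, b, c\<close> share a cell with \<open>e\<close>; the three odd ones remain.\<close>
  then consider "x = b" "y = a" "z = c" | "x = a" "y = c" "z = b" | "x = c" "y = b" "z = a"
    using disj unfolding e_eq f_eq by blast
  then show False
  proof cases
    case 1
    show False
      by (rule no_short_SOS [OF _ is_SOS_common_column [OF perms(5)]])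
        (use e f e_eq f_eq neq 1 in auto)
  next
    case 2
    show False
      by (rule no_short_SOS [OF _ is_SOS_common_row [OF abc]]) (use e f e_eq f_eq neq 2 in auto)
  next
    case 3
    show False
      by (rule no_short_SOS [OF _ is_SOS_opposite_paths [OF abc]]) (use e f e_eq f_eq neq 3 in auto)
  qed
qed

lemma R_of_extremal_le: "R_of G \<le> 10"
proof -
  have "card (two_edges G) \<le> 1"
    using two_edges_unique by (simp add: card_le_Suc0_iff_eq finite_edges(2) [OF config])
  then show ?thesis
    by (simp add: R_of_def extremal card_extremal_cells)
qed

lemma two_edges_path:
  assumes "R_of G = 10"
  obtains a b c where "{a, b, c} = {1, 2, 3}" "two_edges G = {{(a, b), (b, c)}}"
proof -
  have "card (two_edges G) = 1"
    using assms by (simp add: R_of_def extremal card_extremal_cells)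
  then obtain e where e: "two_edges G = {e}"
    by (auto simp: card_1_singleton_iff)
  then have "e \<in> two_edges G"
    by simp
  then obtain a b c where "{a, b, c} = {1, 2, 3}" "e = {(a, b), (b, c)}"
    by (rule two_edge_path)
  then show thesis
    using that e by blast
qed

end

section \<open>The admissible representative\<close>

definition path_config :: config where
  "path_config = Config extremal_cells {{(1, 2), (2, 3)}}"

lemma path_config_simps [simp]:
  "one_edges path_config = extremal_cells" "two_edges path_config = {{(1, 2), (2, 3)}}"
  by (simp_all add: path_config_def)

lemma occupied_path_config: "occupied path_config = insert (1, 2) (insert (2, 3) extremal_cells)"
  by (auto simp: occupied_def selected_edges_def)

lemma path_config_configs: "path_config \<in> configs 4 4"
  by (auto simp: configs_def extremal_cells_def grid_4_4)

lemma simple_path_config: "simple_config path_config"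
  by (auto simp: simple_config_def disjoint_def selected_edges_def extremal_cells_123)

lemma limited_path_config: "limited 4 4 path_config"
  by (simp add: limited_def path_config_configs simple_path_config C4_free_extremal_cells
      card_extremal_cells zarankiewicz_4_4)

lemma R_of_path_config: "R_of path_config = 10"
  by (simp add: R_of_def card_extremal_cells)

text \<open>Apart from reflexivity, symmetry and transitivity, every rule for \<open>sim\<close>
  joins the halves of a two-edge. In a simple configuration distinct edges thus always lie in
  distinct classes.\<close>

lemma sim_same_edge:
  assumes "simple_config G" "sim G p q"
  shows "\<exists>e\<in>selected_edges G. p \<in> e \<and> q \<in> e"
proof -
  have \<delta>: "\<exists>e\<in>selected_edges G. p \<in> e \<and> q \<in> e" if "\<delta> G p q" for p q
    using that by (auto simp: \<delta>_def selected_edges_def)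
  \<comment> \<open>The trivial claim about \<open>perp\<close> is only there to match the
    simultaneous induction rule.\<close>
  have *: "sim G p q \<Longrightarrow> \<exists>e\<in>selected_edges G. p \<in> e \<and> q \<in> e" and "perp G p q \<Longrightarrow> True"
  proof (induction rule: sim_perp.inducts)
    case (sim_trans p q r)
    then show ?case
      using edge_eq [OF assms(1)] by metis
  next
    case (sim_refl p)
    then show ?case
      by (auto simp: occupied_def)
  qed (use \<delta> in blast)+
  show ?thesis
    using * assms(2) by blast
qed

text \<open>These pairs follow in one step, by the line rule or by transfer from a diagonal with an
  unoccupied corner.\<close>

lemma perp_open:
  assumes "p \<in> occupied G" "q \<in> occupied G" "p \<noteq> q" "\<not> \<delta> G p q"
    and "\<not> collinear p q \<Longrightarrow> \<not> \<delta> G (fst p, snd q) (fst q, snd p) \<and>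
      ((fst p, snd q) \<notin> occupied G \<or> (fst q, snd p) \<notin> occupied G)"
  shows "perp G p q"
proof (cases "collinear p q")
  case True
  then show ?thesis
    using assms by (intro line_perp)
next
  case False
  then have "diagonals p q (fst p, snd q) (fst q, snd p)"
    by (simp add: diagonals_def collinear_def)
  then show ?thesis
    by (rule rectangle_perp) (use assms False in auto)
qed

text \<open>The opposite diagonal is certified because its corner \<open>(1, 3)\<close> is
  unoccupied.\<close>

lemma sim_path_config: "sim path_config (1, 2) (2, 3)"
  by (rule rectangle_sim [of _ _ "(1, 3)" "(2, 2)"])
    (simp_all add: diagonals_def \<delta>_def occupied_path_config extremal_cells_123 doubleton_eq_iff)

text \<open>
  Rectangle transfer alone settles all pairs but the diagonals of the four fully occupied
  rectangles through a half of the two-edge. There the diagonal containing that half is certified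
  by exchanging it for the other half, using saturation.
\<close>

lemma perp_path_config:
  assumes "p \<in> occupied path_config" "q \<in> occupied path_config" "p \<noteq> q" "{p, q} \<noteq> {(1, 2), (2, 3)}"
  shows "perp path_config p q"
proof -
  let ?O = "occupied path_config"
  define opened where "opened p q \<longleftrightarrow> p \<noteq> q \<and> \<not> \<delta> path_config p q \<and>
    (\<not> collinear p q \<longrightarrow> \<not> \<delta> path_config (fst p, snd q) (fst q, snd p) \<and>
      ((fst p, snd q) \<notin> ?O \<or> (fst q, snd p) \<notin> ?O))" for p q
  have opened: "perp path_config p q" if "p \<in> ?O" "q \<in> ?O" "opened p q" for p q
    using that perp_open unfolding opened_def by blast
  note simps = opened_def collinear_def \<delta>_def occupied_path_config extremal_cells_123 doubleton_eq_iff
  have half: "perp path_config r h"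
    if "r \<in> ?O" "h' \<in> ?O" "opened r h'" "(h, h') = ((1, 2), (2, 3)) \<or> (h, h') = ((2, 3), (1, 2))" for r h h'
  proof -
    have "sim path_config h h'"
      using that(4) sim_path_config sim_sym by auto
    then show ?thesis
      using saturation [OF sim_refl] opened that(1-3) by blast
  qed
  have halves: "perp path_config (4, 1) (1, 2)" "perp path_config (2, 4) (1, 2)"
    "perp path_config (4, 2) (2, 3)" "perp path_config (3, 4) (2, 3)"
    by (rule half [of _ "(2, 3)"] half [of _ "(1, 2)"]; simp add: simps)+
  have transfer: "perp path_config r s"
    if "perp path_config (fst r, snd s) (fst s, snd r)" "r \<in> ?O" "s \<in> ?O"
      "fst r \<noteq> fst s" "snd r \<noteq> snd s" "\<not> \<delta> path_config r s"
      "\<not> \<delta> path_config (fst r, snd s) (fst s, snd r)" for r s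
    by (rule rectangle_perp [of _ _ "(fst r, snd s)" "(fst s, snd r)"])
      (use that in \<open>auto simp: diagonals_def\<close>)
  have others: "perp path_config (4, 2) (1, 1)" "perp path_config (2, 2) (1, 4)"
    "perp path_config (4, 3) (2, 2)" "perp path_config (3, 3) (2, 4)"
    using transfer [of "(4, 2)" "(1, 1)"] transfer [of "(2, 2)" "(1, 4)"]
      transfer [of "(4, 3)" "(2, 2)"] transfer [of "(3, 3)" "(2, 4)"] halves
    by (simp_all add: simps)
  let ?X = "{((4, 1), (1, 2)), ((2, 4), (1, 2)), ((4, 2), (2, 3)), ((3, 4), (2, 3)),
    ((4, 2), (1, 1)), ((2, 2), (1, 4)), ((4, 3), (2, 2)), ((3, 3), (2, 4))} :: (cell \<times> cell) set"
  \<comment> \<open>Exhaustive check over the eleven occupied cells: beyond the pairs settled in one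
    step, only the eight pairs in \<open>?X\<close> remain.\<close>
  have "\<forall>p\<in>?O. \<forall>q\<in>?O. p = q \<or> {p, q} = {(1, 2), (2, 3)} \<or> opened p q \<or> (p, q) \<in> ?X \<or> (q, p) \<in> ?X"
    by (simp add: simps)
  from bspec [OF bspec [OF this assms(1)] assms(2)] assms(3,4)
  have "opened p q \<or> (p, q) \<in> ?X \<or> (q, p) \<in> ?X"
    by (simp only: simp_thms)
  moreover have X: "perp path_config r s" if "(r, s) \<in> ?X" for r s
    using that halves others by auto
  ultimately show ?thesis
    by (elim disjE opened [OF assms(1,2)] X perp_sym [OF X])
qed

lemma admissible_path_config: "RW3_plus_admissible path_config"
  unfolding RW3_plus_admissible_def
proof (intro conjI ballI impI)
  fix e p q
  assume "e \<in> two_edges path_config" "p \<in> e" "q \<in> e"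
  then show "sim path_config p q"
    using sim_path_config sim_sym [OF sim_path_config] sim_refl [of p path_config]
    by (auto simp: occupied_path_config)
next
  fix e f p q
  assume "e \<in> selected_edges path_config" "f \<in> selected_edges path_config" "e \<noteq> f" "p \<in> e" "q \<in> f"
  then show "\<not> sim path_config p q"
    using sim_same_edge [OF simple_path_config] edge_eq [OF simple_path_config] by metis
next
  fix e f
  assume e: "e \<in> selected_edges path_config" and f: "f \<in> selected_edges path_config" and neq: "e \<noteq> f"
  obtain p q where pq: "p \<in> e" "q \<in> f"
    using selected_edges_props(4) [OF path_config_configs] e f by blast
  have edge: "{(1, 2), (2, 3)} \<in> selected_edges path_config"
    by (simp add: selected_edges_def)
  have "p \<noteq> q" "{p, q} \<noteq> {(1, 2), (2, 3)}"
    using edge_eq [OF simple_path_config] e f neq pq edge by blast+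
  then have "perp path_config p q"
    using pq e f by (intro perp_path_config) (auto simp: occupied_def)
  then show "\<exists>p\<in>e. \<exists>q\<in>f. perp path_config p q"
    using pq by blast
qed

lemma irreducible_path_config: "irreducible_config 4 4 path_config"
  by (rule admissible_irreducible [OF path_config_configs simple_path_config admissible_path_config])

section \<open>Reduction to the representative\<close>

lemma limited_isomorphic_extremal:
  assumes "limited 4 4 G"
  obtains H where "(H, G) \<in> isomorphic_rel 4 4" "one_edges H = extremal_cells"
proof -
  have G: "G \<in> configs 4 4" "C4_free (one_edges G)" "card (one_edges G) = 9"
    using assms by (simp_all add: limited_def zarankiewicz_4_4)
  then have "one_edges G \<subseteq> grid 4 4"
    by (simp add: configs_def)
  then obtain \<sigma> \<tau> where *: "\<sigma> permutes {1..4}" "\<tau> permutes {1..4}"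
    and E: "one_edges G = map_prod \<sigma> \<tau> ` extremal_cells"
    using C4_free_9_isomorphic G(2,3) by metis
  let ?H = "act (inv \<sigma>) (inv \<tau>) G"
  have "(?H, G) \<in> isomorphic_rel 4 4"
    by (rule isomorphic_sym [OF act_isomorphic [OF permutes_inv [OF *(1)] permutes_inv [OF *(2)] G(1)]])
  moreover have "one_edges ?H = extremal_cells"
    by (simp add: act_def E map_prod_inv_image [OF *])
  ultimately show thesis
    by (rule that)
qed

lemma R_of_limited_irreducible_le:
  assumes "limited 4 4 G" "irreducible_config 4 4 G"
  shows "R_of G \<le> 10"
proof -
  obtain H where H: "(H, G) \<in> isomorphic_rel 4 4" "one_edges H = extremal_cells"
    using limited_isomorphic_extremal [OF assms(1)] .
  note iso = isomorphic_sym [OF H(1)]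
  show ?thesis
    using R_of_extremal_le [OF isomorphic_limited [OF iso assms(1)] isomorphic_irreducible [OF iso assms(2)] H(2)]
    by (simp add: isomorphic_R_of(1) [OF H(1)])
qed

text \<open>A single permutation fixing 4, applied to rows and columns alike, preserves the extremal
  cells and carries the labels 1, 2, 3 to \<open>a, b, c\<close>.\<close>

lemma path_config_relabel:
  assumes abc: "{a, b, c} = {1, 2, 3}" and H: "one_edges H = extremal_cells" "two_edges H = {{(a, b), (b, c)}}"
  shows "(path_config, H) \<in> isomorphic_rel 4 4"
proof -
  define \<rho> where "\<rho> i = (if i = 1 then a else if i = 2 then b else if i = 3 then c else i)" for i :: nat
  have \<rho>: "\<rho> 1 = a" "\<rho> 2 = b" "\<rho> 3 = c" "\<rho> 4 = 4"
    by (simp_all add: \<rho>_def)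
  have "\<rho> ` {1, 2, 3, 4} = insert 4 {a, b, c}"
    using \<rho> by auto
  also have "\<dots> = {1, 2, 3, 4}"
    unfolding abc by auto
  finally have image: "\<rho> ` {1, 2, 3, 4} = {1, 2, 3, 4}" .
  then have "inj_on \<rho> {1, 2, 3, 4}"
    by (intro eq_card_imp_inj_on) simp_all
  then have permutes: "\<rho> permutes {1..4}"
    unfolding atLeastAtMost_1_4 using image
    by (intro bij_imp_permutes) (auto simp: bij_betw_def \<rho>_def)
  have "map_prod \<rho> \<rho> ` extremal_cells = extremal_cells"
    by (subst extremal_cells_123)
      (simp only: image_insert image_empty map_prod_simp \<rho> extremal_cells_eq [OF abc, symmetric])
  then have "act \<rho> \<rho> path_config = H"
    using H \<rho> by (cases H) (simp add: act_def)
  then show ?thesis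
    using act_isomorphic [OF permutes permutes path_config_configs] by simp
qed

lemma limited_irreducible_isomorphic:
  assumes "limited 4 4 G" "irreducible_config 4 4 G" "R_of G = 10"
  shows "(path_config, G) \<in> isomorphic_rel 4 4"
proof -
  obtain H where H: "(H, G) \<in> isomorphic_rel 4 4" "one_edges H = extremal_cells"
    using limited_isomorphic_extremal [OF assms(1)] .
  note iso = isomorphic_sym [OF H(1)]
  have "R_of H = 10"
    using isomorphic_R_of(1) [OF iso] assms(3) by simp
  then obtain a b c where "{a, b, c} = {1, 2, 3}" "two_edges H = {{(a, b), (b, c)}}"
    using two_edges_path [OF isomorphic_limited [OF iso assms(1)] isomorphic_irreducible [OF iso assms(2)] H(2)]
    by metis
  then have "(path_config, H) \<in> isomorphic_rel 4 4"
    using path_config_relabel H(2) by blast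
  then show ?thesis
    using H(1) equiv_isomorphic_rel by (meson equivE transE)
qed

section \<open>The values of the parameters and the isomorphism class\<close>

lemma z2_4_4: "z2 4 4 = 10"
  unfolding z2_def
proof (rule Max_eqI)
  show "finite (R_of ` {G. limited 4 4 G \<and> irreducible_config 4 4 G})"
    by (rule finite_subset [of _ "{..10}"]) (use R_of_limited_irreducible_le in auto)
  show "10 \<in> R_of ` {G. limited 4 4 G \<and> irreducible_config 4 4 G}"
    using limited_path_config irreducible_path_config R_of_path_config by force
qed (use R_of_limited_irreducible_le in auto)

lemma z_RL_4_4: "z_RL 4 4 = 10"
  unfolding z_RL_def
proof (rule Max_eqI)
  \<comment> \<open>Admissible configurations are irreducible, so the bound for irreducible ones
    applies.\<close>
  have le: "R_of G \<le> 10" if "limited 4 4 G" "RW3_plus_admissible G" for G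
    using that admissible_irreducible by (intro R_of_limited_irreducible_le) (auto simp: limited_def)
  show "finite (R_of ` {G. limited 4 4 G \<and> RW3_plus_admissible G})"
    by (rule finite_subset [of _ "{..10}"]) (use le in auto)
  show "10 \<in> R_of ` {G. limited 4 4 G \<and> RW3_plus_admissible G}"
    using limited_path_config admissible_path_config R_of_path_config by force
  show "k \<le> 10" if "k \<in> R_of ` {G. limited 4 4 G \<and> RW3_plus_admissible G}" for k
    using that le by auto
qed

theorem theorem3p2:
  fixes z_SL :: "nat \<Rightarrow> nat \<Rightarrow> int"
  assumes "int (z2 4 4) \<ge> z_SL 4 4" and "z_SL 4 4 \<ge> int (z_RL 4 4)"
  shows "z2 4 4 = 10 \<and> z_SL 4 4 = 10 \<and> z_RL 4 4 = 10 \<and>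
    {G. limited 4 4 G \<and> irreducible_config 4 4 G \<and> R_of G = 10}
      \<in> configs 4 4 // isomorphic_rel 4 4"
proof (intro conjI)
  show "z2 4 4 = 10" "z_RL 4 4 = 10"
    by (fact z2_4_4 z_RL_4_4)+
  then show "z_SL 4 4 = 10"
    using assms by simp
  \<comment> \<open>The optimal configurations are exactly the equivalence class of
    \<open>path_config\<close>; the reverse inclusion holds because all three properties are
    isomorphism invariant.\<close>
  have "{G. limited 4 4 G \<and> irreducible_config 4 4 G \<and> R_of G = 10} = isomorphic_rel 4 4 `` {path_config}"
  proof (intro subset_antisym subsetI)
    fix G
    assume "G \<in> isomorphic_rel 4 4 `` {path_config}"
    then have iso: "(path_config, G) \<in> isomorphic_rel 4 4"
      by simp
    show "G \<in> {G. limited 4 4 G \<and> irreducible_config 4 4 G \<and> R_of G = 10}"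
      using isomorphic_limited [OF iso limited_path_config]
        isomorphic_irreducible [OF iso irreducible_path_config] isomorphic_R_of(1) [OF iso] R_of_path_config
      by simp
  qed (use limited_irreducible_isomorphic in auto)
  then show "{G. limited 4 4 G \<and> irreducible_config 4 4 G \<and> R_of G = 10} \<in> configs 4 4 // isomorphic_rel 4 4"
    using quotientI [OF path_config_configs] by simp
qed

end
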